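(* CMPV and RMPV both admit algorithms running in $O(\tau\cdot k^2 m^{2k+1} n)$ time on instances with $n$ agents, $m$ candidates, $\tau$ voting profiles and committee size bound $k$; hence both are contained in XP when parameterized by $k$.
   Context: An instance of CMPV or RMPV consists of a set of agents $A=\{a_1,\dots,a_n\}$, a set of candidates $C=\{c_1,\dots,c_m\}$, a sequence $U=(u_1,\dots,u_\tau)$ of voting profiles with $u_t\colon A\to C\cup\{\emptyset\}$, and integers $k\in\mathbb{N}$, $\ell\in\mathbb{N}_0$, $x\in\mathbb{N}$. For $C'\subseteq C$ let $\mathrm{score}_t(C')=|u_t^{-1}(C')|$. The question is whether there is a sequence $(C_1,\dots,C_\tau)$ of committees $C_t\subseteq C$ with $|C_t|\le k$ and $\mathrm{score}_t(C_t)\ge x$ for all $t$, and for all $t\in\{1,\dots,\tau-1\}$: $|C_t\triangle C_{t+1}|\le \ell$ (CMPV, conservative), respectively $|C_t\triangle C_{t+1}|\ge \ell$ (RMPV, revolutionary). *)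

theory Defs
  imports Complex_Main "HOL-Library.Landau_Symbols" "HOL-Library.Log_Nat"
begin

section \<open>Random access machines\<close>

text \<open>
  A deterministic unit-cost RAM with registers, which a program addresses by constants only, and
  an unbounded memory, which it addresses indirectly. Subtraction is truncated. There is
  deliberately no multiplication: with addition and subtraction alone, \<open>t\<close> steps lengthen the binary
  numbers by at most \<open>O(t)\<close> bits, so that this unit-cost measure is polynomially related to
  Turing machine time.
\<close>

datatype instr =
    Const nat nat        \<comment> \<open>\<open>Const r c\<close>: \<open>r := c\<close>\<close>
  | Add nat nat nat      \<comment> \<open>\<open>Add r p q\<close>: \<open>r := p + q\<close>\<close>
  | Sub nat nat nat      \<comment> \<open>\<open>Sub r p q\<close>: \<open>r := p - q\<close>\<close>
  | Load nat nat         \<comment> \<open>\<open>Load r p\<close>: \<open>r := mem[p]\<close>\<close>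
  | Store nat nat        \<comment> \<open>\<open>Store p q\<close>: \<open>mem[p] := q\<close>\<close>
  | Jump_pos nat nat     \<comment> \<open>\<open>Jump_pos r i\<close>: if \<open>r > 0\<close>, go to instruction \<open>i\<close>\<close>

record config =
  pc :: nat
  reg :: "nat \<Rightarrow> nat"
  mem :: "nat \<Rightarrow> nat"

fun exec :: "instr \<Rightarrow> config \<Rightarrow> config" where
  "exec (Const r c) s = s\<lparr>pc := pc s + 1, reg := (reg s)(r := c)\<rparr>"
| "exec (Add r p q) s = s\<lparr>pc := pc s + 1, reg := (reg s)(r := reg s p + reg s q)\<rparr>"
| "exec (Sub r p q) s = s\<lparr>pc := pc s + 1, reg := (reg s)(r := reg s p - reg s q)\<rparr>"
| "exec (Load r p) s = s\<lparr>pc := pc s + 1, reg := (reg s)(r := mem s (reg s p))\<rparr>"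
| "exec (Store p q) s = s\<lparr>pc := pc s + 1, mem := (mem s)(reg s p := reg s q)\<rparr>"
| "exec (Jump_pos r i) s = s\<lparr>pc := if reg s r > 0 then i else pc s + 1\<rparr>"

definition halted :: "instr list \<Rightarrow> config \<Rightarrow> bool" where
  "halted P s \<longleftrightarrow> length P \<le> pc s"

definition step :: "instr list \<Rightarrow> config \<Rightarrow> config" where
  "step P s = (if halted P s then s else exec (P ! pc s) s)"

text \<open>The input list is stored at the memory cells \<open>0, 1, \<dots>\<close>, and its length in register 0.\<close>

definition init :: "nat list \<Rightarrow> config" where
  "init w = \<lparr>pc = 0, reg = (\<lambda>_. 0)(0 := length w), mem = (\<lambda>i. if i < length w then w ! i else 0)\<rparr>"

definition run :: "instr list \<Rightarrow> nat list \<Rightarrow> nat \<Rightarrow> config" where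
  "run P w t = (step P ^^ t) (init w)"

definition halts :: "instr list \<Rightarrow> nat list \<Rightarrow> bool" where
  "halts P w \<longleftrightarrow> (\<exists>t. halted P (run P w t))"

definition run_time :: "instr list \<Rightarrow> nat list \<Rightarrow> nat" where
  "run_time P w = (LEAST t. halted P (run P w t))"

definition result :: "instr list \<Rightarrow> nat list \<Rightarrow> nat" where
  "result P w = reg (run P w (run_time P w)) 0"

text \<open>
  In the following definition, \<open>D\<close> is the set of instances, \<open>enc\<close> their encoding and \<open>Q\<close> the
  yes-instances. Landau's symbol for the filter \<open>principal D\<close> means that one constant serves
  for all instances in \<open>D\<close>.
\<close>

definition solvable_in_time ::
  "'i set \<Rightarrow> ('i \<Rightarrow> nat list) \<Rightarrow> ('i \<Rightarrow> bool) \<Rightarrow> ('i \<Rightarrow> nat) \<Rightarrow> bool" where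
  "solvable_in_time D enc Q b \<longleftrightarrow>
     (\<exists>P. (\<forall>i\<in>D. halts P (enc i) \<and> result P (enc i) = of_bool (Q i)) \<and>
          (\<lambda>i. real (run_time P (enc i))) \<in> O[principal D](\<lambda>i. real (b i)))"


section \<open>The class XP\<close>

definition computable :: "(nat \<Rightarrow> nat) \<Rightarrow> bool" where
  "computable f \<longleftrightarrow> (\<exists>P. \<forall>k. halts P [k] \<and> result P [k] = f k)"

text \<open>Numbers are measured by their binary length, plus one symbol as a separator.\<close>

definition input_size :: "nat list \<Rightarrow> nat" where
  "input_size w = (\<Sum>v\<leftarrow>w. floorlog 2 v + 1)"

text \<open>
  A parameterized problem is a set of pairs \<open>(w, k)\<close> of a word and a parameter; the pair is
  presented to a machine as the list \<open>k # w\<close>. The decision procedure has to be correct, and to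
  meet the time bound, on all words, including those that do not encode anything.
\<close>

definition XP :: "(nat list \<times> nat) set set" where
  "XP = {L. \<exists>P f g. computable f \<and> computable g \<and>
     (\<forall>w k. halts P (k # w) \<and> result P (k # w) = of_bool ((w, k) \<in> L) \<and>
            run_time P (k # w) \<le> f k * input_size (k # w) ^ g k)}"


section \<open>Conservative and revolutionary multistage plurality voting\<close>

text \<open>
  Agents, candidates and time steps are identified with their indices, which start at 1. The bounds
  \<open>k\<close>, \<open>l\<close>, \<open>x\<close> are \<open>size_bound\<close>, \<open>change_bound\<close>, \<open>score_bound\<close>.
  \<open>vote I t a\<close> is \<open>u\<^sub>t(a)\<close>, where \<open>None\<close> stands for \<open>\<emptyset>\<close>.
\<close>

record mpv_instance =
  num_agents :: nat
  num_cands :: nat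
  num_profiles :: nat
  vote :: "nat \<Rightarrow> nat \<Rightarrow> nat option"
  size_bound :: nat
  change_bound :: nat
  score_bound :: nat

definition agents :: "mpv_instance \<Rightarrow> nat set" where
  "agents I = {1..num_agents I}"

definition cands :: "mpv_instance \<Rightarrow> nat set" where
  "cands I = {1..num_cands I}"

text \<open>The numbers \<open>k\<close> and \<open>x\<close> are positive, while \<open>l\<close> may be 0.\<close>

definition mpv_instances :: "mpv_instance set" where
  "mpv_instances = {I. num_agents I \<ge> 1 \<and> num_cands I \<ge> 1 \<and> num_profiles I \<ge> 1 \<and>
     size_bound I \<ge> 1 \<and> score_bound I \<ge> 1 \<and>
     (\<forall>t\<in>{1..num_profiles I}. \<forall>a\<in>agents I. vote I t a \<in> insert None (Some ` cands I))}"

definition score :: "mpv_instance \<Rightarrow> nat \<Rightarrow> nat set \<Rightarrow> nat" where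
  "score I t C' = card {a \<in> agents I. vote I t a \<in> Some ` C'}"

definition committees :: "mpv_instance \<Rightarrow> (nat \<Rightarrow> nat set) \<Rightarrow> bool" where
  "committees I C \<longleftrightarrow> (\<forall>t\<in>{1..num_profiles I}.
     C t \<subseteq> cands I \<and> card (C t) \<le> size_bound I \<and> score I t (C t) \<ge> score_bound I)"

definition CMPV :: "mpv_instance \<Rightarrow> bool" where
  "CMPV I \<longleftrightarrow> (\<exists>C. committees I C \<and>
     (\<forall>t\<in>{1..<num_profiles I}. card (sym_diff (C t) (C (t + 1))) \<le> change_bound I))"

definition RMPV :: "mpv_instance \<Rightarrow> bool" where
  "RMPV I \<longleftrightarrow> (\<exists>C. committees I C \<and>
     (\<forall>t\<in>{1..<num_profiles I}. card (sym_diff (C t) (C (t + 1))) \<ge> change_bound I))"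

text \<open>
  An instance contains the set of candidates, and not just its cardinality in binary. The encoding
  therefore lists the candidates, which makes its length at least \<open>m\<close>; the agents are the
  positions in the rows of the voting profiles, of which there are \<open>n\<close> in each.
\<close>

definition encode_vote :: "nat option \<Rightarrow> nat" where
  "encode_vote v = (case v of None \<Rightarrow> 0 | Some c \<Rightarrow> c)"

definition encode_without_k :: "mpv_instance \<Rightarrow> nat list" where
  "encode_without_k I =
     [change_bound I, score_bound I, num_agents I, num_cands I, num_profiles I]
     @ [1..<num_cands I + 1]
     @ concat (map (\<lambda>t. map (\<lambda>a. encode_vote (vote I t a)) [1..<num_agents I + 1])
         [1..<num_profiles I + 1])"

definition encode :: "mpv_instance \<Rightarrow> nat list" where
  "encode I = size_bound I # encode_without_k I"

definition parameterized_by_k :: "(mpv_instance \<Rightarrow> bool) \<Rightarrow> (nat list \<times> nat) set" where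
  "parameterized_by_k Q = {(encode_without_k I, size_bound I) | I. I \<in> mpv_instances \<and> Q I}"

end

theory Submission
  imports Defs
begin

text \<open>
  As \<open>x \<ge> 1\<close>, the empty committee never qualifies, so the admissible committees are the sets of
  entries of the \<open>m\<^sup>k\<close> tuples in \<open>{1..m}\<^sup>k\<close>. The machine tabulates their characteristic vectors and
  computes, time step by time step, which of them can end a partial solution: a committee with
  sufficient score can if some admissible predecessor can and the symmetric difference of the two
  is right. A step compares \<open>m\<^sup>2\<^sup>k\<close> pairs in time \<open>O(m)\<close> each and computes \<open>m\<^sup>k\<close> scores in time \<open>O(n)\<close>
  each. For membership in XP, the input is validated first, in linear time, and the factor
  \<open>k\<^sup>2\<close> of the time bound is absorbed by the exponent since \<open>k \<le> 2\<^sup>k\<close>.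
\<close>

section \<open>Structured programs\<close>

datatype com =
    Blk "instr list"
  | Seq com com  (infixr ";;" 60)
  | Unless nat com
  | Repeat com nat

fun csize :: "com \<Rightarrow> nat" where
  "csize (Blk is) = length is"
| "csize (a ;; b) = csize a + csize b"
| "csize (Unless r c) = Suc (csize c)"
| "csize (Repeat c r) = Suc (csize c)"

text \<open>
  \<open>Unless r c\<close> skips \<open>c\<close> if register \<open>r\<close> is positive, and \<open>Repeat c r\<close> is a do-while loop: both
  need only the one conditional jump of the machine.
\<close>

fun compile :: "nat \<Rightarrow> com \<Rightarrow> instr list" where
  "compile a (Blk is) = is"
| "compile a (c ;; d) = compile a c @ compile (a + csize c) d"
| "compile a (Unless r c) = Jump_pos r (Suc (a + csize c)) # compile (Suc a) c"
| "compile a (Repeat c r) = compile a c @ [Jump_pos r a]"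

fun writes :: "instr \<Rightarrow> nat set" where
  "writes (Const r c) = {r}"
| "writes (Add r p q) = {r}"
| "writes (Sub r p q) = {r}"
| "writes (Load r p) = {r}"
| "writes (Store p q) = {}"
| "writes (Jump_pos r i) = {}"

fun mods :: "com \<Rightarrow> nat set" where
  "mods (Blk is) = \<Union> (set (map writes is))"
| "mods (a ;; b) = mods a \<union> mods b"
| "mods (Unless r c) = mods c"
| "mods (Repeat c r) = mods c"

lemma length_compile [simp]: "length (compile a c) = csize c"
  by (induction c arbitrary: a) auto

definition code_at :: "instr list \<Rightarrow> nat \<Rightarrow> instr list \<Rightarrow> bool" where
  "code_at P a is \<longleftrightarrow> (\<exists>pre post. P = pre @ is @ post \<and> length pre = a)"

lemma code_at_append:
  "code_at P a (is @ js) \<Longrightarrow> code_at P a is \<and> code_at P (a + length is) js"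
  unfolding code_at_def by (metis append.assoc length_append)

lemma code_at_Cons:
  assumes "code_at P a (i # is)"
  shows "a < length P" "P ! a = i" "code_at P (Suc a) is"
proof -
  from assms obtain pre post where *: "P = pre @ (i # is) @ post" "length pre = a"
    unfolding code_at_def by blast
  show "a < length P" "P ! a = i" using * by (auto simp: nth_append)
  have "P = (pre @ [i]) @ is @ post" "length (pre @ [i]) = Suc a" using * by auto
  then show "code_at P (Suc a) is" unfolding code_at_def by blast
qed

type_synonym store = "nat \<Rightarrow> nat"

definition conf :: "nat \<Rightarrow> store \<Rightarrow> store \<Rightarrow> config" where
  "conf a g h = \<lparr>pc = a, reg = g, mem = h\<rparr>"

lemma step_conf: "a < length P \<Longrightarrow> step P (conf a g h) = exec (P ! a) (conf a g h)"
  by (simp add: step_def halted_def conf_def)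

definition same_except :: "nat set \<Rightarrow> store \<Rightarrow> store \<Rightarrow> bool" where
  "same_except R g g' \<longleftrightarrow> (\<forall>r. r \<notin> R \<longrightarrow> g' r = g r)"

definition executes :: "com \<Rightarrow> nat \<Rightarrow> store \<Rightarrow> store \<Rightarrow> store \<Rightarrow> store \<Rightarrow> bool" where
  "executes c t g h g' h' \<longleftrightarrow> (\<forall>P a. code_at P a (compile a c) \<longrightarrow>
     (step P ^^ t) (conf a g h) = conf (a + csize c) g' h')"

lemma executesD:
  "executes c t g h g' h' \<Longrightarrow> code_at P a (compile a c) \<Longrightarrow>
    (step P ^^ t) (conf a g h) = conf (a + csize c) g' h'"
  unfolding executes_def by blast

definition reaches ::
  "com \<Rightarrow> store \<Rightarrow> store \<Rightarrow> nat \<Rightarrow> (store \<Rightarrow> store \<Rightarrow> bool) \<Rightarrow> bool" where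
  "reaches c g h T Q \<longleftrightarrow> (\<exists>t g' h'. t \<le> T \<and> Q g' h' \<and> same_except (mods c) g g' \<and>
     executes c t g h g' h')"

lemma reachesE:
  assumes "reaches c g h T Q"
  obtains t g' h' where "t \<le> T" "Q g' h'" "same_except (mods c) g g'" "executes c t g h g' h'"
  using assms unfolding reaches_def by blast

lemma reachesI:
  assumes "t \<le> T" "Q g' h'" "same_except (mods c) g g'"
    "\<And>P a. code_at P a (compile a c) \<Longrightarrow> (step P ^^ t) (conf a g h) = conf (a + csize c) g' h'"
  shows "reaches c g h T Q"
  using assms unfolding reaches_def executes_def by blast

lemma reaches_conseq:
  assumes "reaches c g h T Q" "T \<le> T'"
    "\<And>g' h'. Q g' h' \<Longrightarrow> same_except (mods c) g g' \<Longrightarrow> Q' g' h'"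
  shows "reaches c g h T' Q'"
  using assms unfolding reaches_def by (meson le_trans)

fun wp :: "instr list \<Rightarrow> (store \<Rightarrow> store \<Rightarrow> bool) \<Rightarrow> store \<Rightarrow> store \<Rightarrow> bool" where
  "wp [] Q g h = Q g h"
| "wp (Const r c # is) Q g h = wp is Q (g(r := c)) h"
| "wp (Add r p q # is) Q g h = wp is Q (g(r := g p + g q)) h"
| "wp (Sub r p q # is) Q g h = wp is Q (g(r := g p - g q)) h"
| "wp (Load r p # is) Q g h = wp is Q (g(r := h (g p))) h"
| "wp (Store p q # is) Q g h = wp is Q g (h(g p := g q))"
| "wp (Jump_pos r i # is) Q g h = False"

lemma reaches_Blk_exact:
  assumes "wp is Q g h"
  shows "reaches (Blk is) g h (length is) Q"
proof -
  have "\<exists>g' h'. Q g' h' \<and> same_except (\<Union> (set (map writes is))) g g' \<and>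
     (\<forall>P a. code_at P a is \<longrightarrow>
        (step P ^^ length is) (conf a g h) = conf (a + length is) g' h')"
    using assms
  proof (induction "is" arbitrary: g h)
    case Nil
    then show ?case by (auto simp: same_except_def)
  next
    case (Cons i "is")
    obtain g1 h1 where 1: "wp is Q g1 h1" "same_except (writes i) g g1"
      "\<And>a. exec i (conf a g h) = conf (Suc a) g1 h1"
      using Cons.prems by (cases i) (auto simp: conf_def same_except_def)
    from Cons.IH[OF 1(1)] obtain g' h' where 2: "Q g' h'"
      "same_except (\<Union> (set (map writes is))) g1 g'"
      "\<And>P a. code_at P a is \<Longrightarrow> (step P ^^ length is) (conf a g1 h1) = conf (a + length is) g' h'"
      by blast
    have "(step P ^^ length (i # is)) (conf a g h) = conf (a + length (i # is)) g' h'"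
      if "code_at P a (i # is)" for P a
    proof -
      note c = code_at_Cons[OF that]
      have "(step P ^^ length (i # is)) (conf a g h) = (step P ^^ length is) (step P (conf a g h))"
        by (simp add: funpow_swap1)
      then show ?thesis using 1(3) 2(3)[OF c(3)] c by (simp add: step_conf)
    qed
    moreover have "same_except (\<Union> (set (map writes (i # is)))) g g'"
      using 1(2) 2(2) by (auto simp: same_except_def)
    ultimately show ?case using 2(1) by blast
  qed
  then obtain g' h' where "Q g' h'" "same_except (mods (Blk is)) g g'"
    "\<And>P a. code_at P a is \<Longrightarrow> (step P ^^ length is) (conf a g h) = conf (a + length is) g' h'"
    by auto
  then show ?thesis by (intro reachesI[of "length is" _ Q g' h']) auto
qed

lemma reaches_Blk: "wp is Q g h \<Longrightarrow> length is \<le> T \<Longrightarrow> reaches (Blk is) g h T Q"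
  by (rule reaches_conseq[OF reaches_Blk_exact])

lemma reaches_Seq:
  assumes "reaches c g h T1 R"
    and "\<And>g' h'. R g' h' \<Longrightarrow> same_except (mods c) g g' \<Longrightarrow> reaches d g' h' T2 Q"
    and "T1 + T2 \<le> T"
  shows "reaches (c ;; d) g h T Q"
proof -
  from assms(1) obtain t g1 h1 where 1: "t \<le> T1" "R g1 h1" "same_except (mods c) g g1"
    "executes c t g h g1 h1"
    by (rule reachesE)
  from assms(2)[OF 1(2,3)] obtain u g2 h2 where 2: "u \<le> T2" "Q g2 h2" "same_except (mods d) g1 g2"
    "executes d u g1 h1 g2 h2"
    by (rule reachesE)
  show ?thesis
  proof (rule reachesI[of "u + t" _ _ g2 h2])
    show "u + t \<le> T" using 1 2 assms(3) by linarith
    show "same_except (mods (c ;; d)) g g2" using 1(3) 2(3) by (simp add: same_except_def)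
    fix P a assume "code_at P a (compile a (c ;; d))"
    then have "code_at P a (compile a c)" "code_at P (a + csize c) (compile (a + csize c) d)"
      by (auto dest: code_at_append)
    then show "(step P ^^ (u + t)) (conf a g h) = conf (a + csize (c ;; d)) g2 h2"
      using executesD[OF 1(4)] executesD[OF 2(4)] by (simp add: funpow_add add.assoc)
  qed (use 2 in simp)
qed

lemma reaches_Blk_Seq:
  assumes "wp is (\<lambda>g' h'. reaches c g' h' T' Q) g h" and "length is + T' \<le> T"
  shows "reaches (Blk is ;; c) g h T Q"
  by (rule reaches_Seq[OF reaches_Blk_exact[OF assms(1)] _ assms(2)])

lemma reaches_Unless:
  assumes "g r = 0 \<Longrightarrow> reaches c g h T Q" and "g r \<noteq> 0 \<Longrightarrow> Q g h" and "Suc T \<le> T'"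
  shows "reaches (Unless r c) g h T' Q"
proof (cases "g r = 0")
  case True
  from assms(1)[OF True] obtain t g1 h1 where 1: "t \<le> T" "Q g1 h1" "same_except (mods c) g g1"
    "executes c t g h g1 h1"
    by (rule reachesE)
  show ?thesis
  proof (rule reachesI[of "Suc t" _ _ g1 h1])
    fix P a assume "code_at P a (compile a (Unless r c))"
    note c = code_at_Cons[OF this[unfolded compile.simps]]
    have "step P (conf a g h) = conf (Suc a) g h"
      using c True by (simp add: step_conf) (simp add: conf_def)
    then show "(step P ^^ Suc t) (conf a g h) = conf (a + csize (Unless r c)) g1 h1"
      using executesD[OF 1(4) c(3)] by (simp add: funpow_swap1)
  qed (use 1 assms(3) in auto)
next
  case False
  show ?thesis
  proof (rule reachesI[of 1 _ _ g h])
    fix P a assume "code_at P a (compile a (Unless r c))"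
    note c = code_at_Cons[OF this[unfolded compile.simps]]
    show "(step P ^^ 1) (conf a g h) = conf (a + csize (Unless r c)) g h"
      using c False by (simp add: step_conf) (simp add: conf_def)
  qed (use False assms in \<open>auto simp: same_except_def\<close>)
qed

lemma reaches_Repeat:
  assumes "I n g h" "0 < n"
    and step: "\<And>n g' h'. I (Suc n) g' h' \<Longrightarrow> same_except (mods c) g g' \<Longrightarrow>
      reaches c g' h' T (\<lambda>g'' h''. g'' r = 0 \<and> Q g'' h'' \<or> 0 < g'' r \<and> 0 < n \<and> I n g'' h'')"
    and "n * Suc T \<le> T'"
  shows "reaches (Repeat c r) g h T' Q"
proof -
  have "reaches (Repeat c r) g' h' (n * Suc T) Q"
    if "I n g' h'" "0 < n" "same_except (mods c) g g'" for n g' h'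
    using that
  proof (induction n arbitrary: g' h')
    case (Suc n)
    from step[OF Suc.prems(1,3)] obtain t g1 h1 where 1: "t \<le> T"
      "g1 r = 0 \<and> Q g1 h1 \<or> 0 < g1 r \<and> 0 < n \<and> I n g1 h1" "same_except (mods c) g' g1"
      "executes c t g' h' g1 h1"
      by (rule reachesE)
    have body: "(step P ^^ Suc t) (conf a g' h') =
        conf (if g1 r > 0 then a else Suc (a + csize c)) g1 h1"
      if "code_at P a (compile a (Repeat c r))" for P a
    proof -
      have "code_at P a (compile a c)" "code_at P (a + csize c) [Jump_pos r a]"
        using that by (auto dest: code_at_append)
      then show ?thesis
        using executesD[OF 1(4)] code_at_Cons[of P "a + csize c" "Jump_pos r a" "[]"]
        by (simp add: step_conf) (simp add: conf_def)
    qed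
    from 1(2) show ?case
    proof
      assume z: "g1 r = 0 \<and> Q g1 h1"
      show ?case
        by (rule reachesI[of "Suc t" _ _ g1 h1]) (use z 1 body in auto)
    next
      assume p: "0 < g1 r \<and> 0 < n \<and> I n g1 h1"
      have "same_except (mods c) g g1" using Suc.prems(3) 1(3) by (simp add: same_except_def)
      with p Suc.IH have "reaches (Repeat c r) g1 h1 (n * Suc T) Q" by blast
      then obtain u g2 h2 where 2: "u \<le> n * Suc T" "Q g2 h2"
        "same_except (mods (Repeat c r)) g1 g2"
        "executes (Repeat c r) u g1 h1 g2 h2"
        by (rule reachesE)
      show ?case
      proof (rule reachesI[of "u + Suc t" _ _ g2 h2])
        show "same_except (mods (Repeat c r)) g' g2" using 1(3) 2(3) by (simp add: same_except_def)
        fix P a assume c: "code_at P a (compile a (Repeat c r))"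
        show "(step P ^^ (u + Suc t)) (conf a g' h') = conf (a + csize (Repeat c r)) g2 h2"
          using body[OF c] executesD[OF 2(4) c] p by (simp only: funpow_add o_apply) simp
      qed (use 1 2 in auto)
    qed
  qed simp
  from this[OF assms(1,2)] have "reaches (Repeat c r) g h (n * Suc T) Q"
    by (simp add: same_except_def)
  then show ?thesis by (rule reaches_conseq) (use assms(4) in auto)
qed

lemma reaches_count:
  assumes "I 0 g h" "g r = n" "0 < n"
    and step: "\<And>i g' h'. i < n \<Longrightarrow> I i g' h' \<Longrightarrow> g' r = n - i \<Longrightarrow> same_except (mods c) g g' \<Longrightarrow>
      reaches c g' h' T (\<lambda>g'' h''. g'' r = n - Suc i \<and> I (Suc i) g'' h'')"
    and "n * Suc T \<le> T'" and "\<And>g' h'. I n g' h' \<Longrightarrow> same_except (mods c) g g' \<Longrightarrow> Q g' h'"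
  shows "reaches (Repeat c r) g h T' Q"
proof -
  have "reaches (Repeat c r) g h T' (I n)"
  proof (rule reaches_Repeat[where I = "\<lambda>j g h. j \<le> n \<and> g r = j \<and> I (n - j) g h", OF _ assms(3) _ assms(5)])
    show "n \<le> n \<and> g r = n \<and> I (n - n) g h" using assms by simp
    fix j g' h' assume *: "Suc j \<le> n \<and> g' r = Suc j \<and> I (n - Suc j) g' h'"
      and f: "same_except (mods c) g g'"
    show "reaches c g' h' T (\<lambda>g'' h''. g'' r = 0 \<and> I n g'' h'' \<or>
        0 < g'' r \<and> 0 < j \<and> j \<le> n \<and> g'' r = j \<and> I (n - j) g'' h'')"
    proof (rule reaches_conseq[OF step[of "n - Suc j", OF _ _ _ f]])
      fix g'' h'' assume "g'' r = n - Suc (n - Suc j) \<and> I (Suc (n - Suc j)) g'' h''"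
      then show "g'' r = 0 \<and> I n g'' h'' \<or>
        0 < g'' r \<and> 0 < j \<and> j \<le> n \<and> g'' r = j \<and> I (n - j) g'' h''"
        using * by (cases j) (auto simp: Suc_diff_Suc)
    qed (use * in auto)
  qed
  then show ?thesis by (rule reaches_conseq) (use assms(6) in auto)
qed

definition mem_of :: "nat list \<Rightarrow> store" where
  "mem_of w = (\<lambda>i. if i < length w then w ! i else 0)"

lemma mem_of_nth [simp]: "i < length w \<Longrightarrow> mem_of w i = w ! i"
  and mem_of_beyond [simp]: "length w \<le> i \<Longrightarrow> mem_of w i = 0"
  by (simp_all add: mem_of_def)

lemma reaches_run:
  assumes "reaches c ((\<lambda>_. 0)(0 := length w)) (mem_of w) T (\<lambda>g h. g 0 = v)"
  shows "halts (compile 0 c) w" "result (compile 0 c) w = v" "run_time (compile 0 c) w \<le> T"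
proof -
  let ?P = "compile 0 c"
  from assms obtain t g' h' where t: "t \<le> T" "g' 0 = v"
    "executes c t ((\<lambda>_. 0)(0 := length w)) (mem_of w) g' h'"
    by (rule reachesE)
  have "code_at ?P 0 ?P" by (auto simp: code_at_def)
  from executesD[OF t(3) this] have r: "run ?P w t = conf (csize c) g' h'"
    by (simp add: run_def init_def conf_def mem_of_def)
  then have H: "halted ?P (run ?P w t)" by (simp add: halted_def conf_def)
  then show "halts ?P w" by (auto simp: halts_def)
  let ?u = "run_time ?P w"
  have u: "?u \<le> t" "halted ?P (run ?P w ?u)"
    unfolding run_time_def by (auto intro: Least_le LeastI[of "\<lambda>t. halted ?P (run ?P w t)"] H)
  then show "?u \<le> T" using t by simp
  have stay: "(step P ^^ d) s = s" if "halted P s" for P d s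
    by (induction d) (use that in \<open>auto simp: step_def\<close>)
  have "run ?P w t = (step ?P ^^ (t - ?u)) (run ?P w ?u)"
    using u(1) unfolding run_def by (metis comp_apply funpow_add le_add_diff_inverse2)
  with stay[OF u(2)] have "run ?P w ?u = run ?P w t" by simp
  with r t(2) show "result ?P w = v" by (simp add: result_def conf_def)
qed

text \<open>
  Register 0 stays zero until the last instruction, which puts the result there, so that
  \<open>Add r p 0\<close> copies \<open>p\<close> to \<open>r\<close>.
\<close>

abbreviation (input) rLen :: nat where "rLen \<equiv> 2"
abbreviation (input) rK :: nat where "rK \<equiv> 3"
abbreviation (input) rL :: nat where "rL \<equiv> 4"
abbreviation (input) rX :: nat where "rX \<equiv> 5"
abbreviation (input) rN :: nat where "rN \<equiv> 6"
abbreviation (input) rM :: nat where "rM \<equiv> 7"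
abbreviation (input) rTau :: nat where "rTau \<equiv> 8"
abbreviation (input) rP :: nat where "rP \<equiv> 9"
abbreviation (input) rB :: nat where "rB \<equiv> 10"
abbreviation (input) rZ :: nat where "rZ \<equiv> 11"
abbreviation (input) rV :: nat where "rV \<equiv> 12"
abbreviation (input) rU :: nat where "rU \<equiv> 13"
abbreviation (input) rCnt :: nat where "rCnt \<equiv> 14"
abbreviation (input) rW :: nat where "rW \<equiv> 15"
abbreviation (input) rS :: nat where "rS \<equiv> 16"
abbreviation (input) rC :: nat where "rC \<equiv> 17"
abbreviation (input) rMM :: nat where "rMM \<equiv> 18"
abbreviation (input) rSrc :: nat where "rSrc \<equiv> 19"
abbreviation (input) rOne :: nat where "rOne \<equiv> 20"
abbreviation (input) rI :: nat where "rI \<equiv> 21"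
abbreviation (input) rD :: nat where "rD \<equiv> 22"
abbreviation (input) rPc :: nat where "rPc \<equiv> 23"
abbreviation (input) rNS :: nat where "rNS \<equiv> 24"
abbreviation (input) rNC :: nat where "rNC \<equiv> 25"
abbreviation (input) rG :: nat where "rG \<equiv> 26"
abbreviation (input) rNG :: nat where "rNG \<equiv> 27"
abbreviation (input) rPj :: nat where "rPj \<equiv> 28"
abbreviation (input) rJ :: nat where "rJ \<equiv> 29"
abbreviation (input) rT :: nat where "rT \<equiv> 30"
abbreviation (input) rVp :: nat where "rVp \<equiv> 31"
abbreviation (input) rSc :: nat where "rSc \<equiv> 32"
abbreviation (input) rFail :: nat where "rFail \<equiv> 33"
abbreviation (input) rGood :: nat where "rGood \<equiv> 34"
abbreviation (input) rGp :: nat where "rGp \<equiv> 35"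
abbreviation (input) rPi :: nat where "rPi \<equiv> 36"
abbreviation (input) rDiff :: nat where "rDiff \<equiv> 37"
abbreviation (input) rLim :: nat where "rLim \<equiv> 38"
abbreviation (input) rAp :: nat where "rAp \<equiv> 39"

section \<open>The table of committees\<close>

fun level :: "nat \<Rightarrow> nat \<Rightarrow> nat set list" where
  "level m 0 = [{}]"
| "level m (Suc p) = concat (map (\<lambda>d. map (insert d) (level m p)) [1..<Suc m])"

lemma length_concat_const:
  "(\<And>x. x \<in> set xs \<Longrightarrow> length (f x) = n) \<Longrightarrow> length (concat (map f xs)) = length xs * n"
  by (induction xs) auto

lemma length_level: "length (level m p) = m ^ p"
  by (induction p) (simp_all add: length_concat_const[where n = "m ^ _"] del: upt_Suc)

lemma set_level:
  "set (level m p) = {C. C \<subseteq> {1..m} \<and> card C \<le> p \<and> (0 < p \<longrightarrow> C \<noteq> {})}"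
proof (induction p)
  case 0
  show ?case by (auto dest: finite_subset[OF _ finite_atLeastAtMost])
next
  case (Suc p)
  have "C \<in> set (level m (Suc p)) \<longleftrightarrow> C \<subseteq> {1..m} \<and> card C \<le> Suc p \<and> C \<noteq> {}" for C
  proof
    assume "C \<in> set (level m (Suc p))"
    then obtain d D where "d \<in> set [1..<Suc m]" "D \<in> set (level m p)" and C: "C = insert d D"
      by (auto simp del: upt_Suc set_upt)
    then have d: "1 \<le> d" "d \<le> m" "D \<subseteq> {1..m}" "card D \<le> p" unfolding Suc.IH by auto
    then show "C \<subseteq> {1..m} \<and> card C \<le> Suc p \<and> C \<noteq> {}"
      using card_insert_le_m1[of "Suc p" D d] C by auto
  next
    assume C: "C \<subseteq> {1..m} \<and> card C \<le> Suc p \<and> C \<noteq> {}"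
    then have fin: "finite C" by (auto dest: finite_subset)
    from C obtain d where d: "d \<in> C" by blast
    define D where "D = (if 0 < p \<and> C = {d} then C else C - {d})"
    have CD: "C = insert d D" using d by (auto simp: D_def)
    have DL: "D \<in> set (level m p)"
      unfolding Suc.IH using C d fin by (auto simp: D_def card_Diff_singleton)
    have "d \<in> set [1..<Suc m]" using C d by auto
    then show "C \<in> set (level m (Suc p))"
      unfolding CD level.simps set_concat set_map
      by (rule UnionI[OF imageI[OF imageI]]) (use DL in simp)
  qed
  then show ?case by (intro set_eqI) (simp only: mem_Collect_eq zero_less_Suc simp_thms)
qed

text \<open>
  A row has a cell for the non-existent candidate 0, so that an abstention, which is encoded as 0,
  can be looked up like any other vote.
\<close>

definition row :: "nat \<Rightarrow> store \<Rightarrow> nat \<Rightarrow> nat set \<Rightarrow> bool" where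
  "row m h p C \<longleftrightarrow> (\<forall>c\<le>m. h (p + c) = of_bool (c \<in> C))"

definition table :: "nat \<Rightarrow> store \<Rightarrow> nat \<Rightarrow> nat set list \<Rightarrow> bool" where
  "table m h p Cs \<longleftrightarrow> (\<forall>i<length Cs. row m h (p + i * Suc m) (Cs ! i))"

lemma row_cong: "row m h p C \<Longrightarrow> (\<And>a. p \<le> a \<Longrightarrow> a \<le> p + m \<Longrightarrow> h' a = h a) \<Longrightarrow> row m h' p C"
  by (simp add: row_def)

lemma row_end: "i < (M::nat) \<Longrightarrow> p + i * Suc m + m < p + M * Suc m"
  using mult_le_mono1[of "Suc i" M "Suc m"] by simp

lemma table_cong:
  assumes "table m h p Cs" "\<And>a. p \<le> a \<Longrightarrow> a < p + length Cs * Suc m \<Longrightarrow> h' a = h a"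
  shows "table m h' p Cs"
  unfolding table_def
proof (intro allI impI)
  fix i assume i: "i < length Cs"
  have "row m h (p + i * Suc m) (Cs ! i)" using assms(1) i by (simp add: table_def)
  then show "row m h' (p + i * Suc m) (Cs ! i)"
    by (rule row_cong) (use row_end[OF i, of p m] in \<open>auto intro!: assms(2)\<close>)
qed

lemma table_append:
  "table m h p (As @ Bs) \<longleftrightarrow> table m h p As \<and> table m h (p + length As * Suc m) Bs"
proof
  assume L: "table m h p (As @ Bs)"
  have "row m h (p + i * Suc m) (As ! i)" if "i < length As" for i
    using L[unfolded table_def, rule_format, of i] that by (simp add: nth_append)
  moreover have "row m h (p + length As * Suc m + i * Suc m) (Bs ! i)" if "i < length Bs" for i
    using L[unfolded table_def, rule_format, of "length As + i"] that
    by (simp add: nth_append algebra_simps)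
  ultimately show "table m h p As \<and> table m h (p + length As * Suc m) Bs"
    by (simp add: table_def)
next
  assume R: "table m h p As \<and> table m h (p + length As * Suc m) Bs"
  show "table m h p (As @ Bs)"
    unfolding table_def
  proof (intro allI impI)
    fix i assume "i < length (As @ Bs)"
    show "row m h (p + i * Suc m) ((As @ Bs) ! i)"
    proof (cases "i < length As")
      case True
      then show ?thesis using R by (simp add: table_def nth_append)
    next
      case False
      then have "i - length As < length Bs" "length As + (i - length As) = i"
        using \<open>i < length (As @ Bs)\<close> by auto
      moreover have "row m h (p + length As * Suc m + (i - length As) * Suc m) (Bs ! (i - length As))"
        using R[THEN conjunct2, unfolded table_def] calculation(1) by blast
      moreover have "p + length As * Suc m + (i - length As) * Suc m = p + i * Suc m"
        using calculation(2) by (metis add.assoc add_mult_distrib)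
      ultimately have "row m h (p + i * Suc m) (Bs ! (i - length As))" by metis
      then show ?thesis using False by (simp add: nth_append)
    qed
  qed
qed

lemma table_snoc:
  "table m h p (As @ [C]) \<longleftrightarrow> table m h p As \<and> row m h (p + length As * Suc m) C"
  by (simp add: table_append) (simp add: table_def)

definition copy_row :: com where
  "copy_row = Repeat (Blk [Load rV rSrc, Store rW rV, Add rSrc rSrc rOne, Add rW rW rOne,
     Sub rCnt rCnt rOne]) rCnt"

lemma mods_copy_row [simp]: "mods copy_row = {rV, rSrc, rW, rCnt}"
  by (auto simp: copy_row_def)

lemma reaches_copy_row:
  assumes "g rOne = 1" "g rCnt = n" "0 < n" "g rSrc + n \<le> g rW"
  shows "reaches copy_row g h (n * 6) (\<lambda>g' h'. g' rSrc = g rSrc + n \<and> g' rW = g rW + n \<and>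
    h' = (\<lambda>a. if g rW \<le> a \<and> a < g rW + n then h (g rSrc + (a - g rW)) else h a))"
  unfolding copy_row_def
proof (rule reaches_count[where n = n and T = 5 and
    I = "\<lambda>i g' h'. g' rSrc = g rSrc + i \<and> g' rW = g rW + i \<and>
      h' = (\<lambda>a. if g rW \<le> a \<and> a < g rW + i then h (g rSrc + (a - g rW)) else h a)"])
  fix i g' h'
  assume *: "i < n" "g' rSrc = g rSrc + i \<and> g' rW = g rW + i \<and>
      h' = (\<lambda>a. if g rW \<le> a \<and> a < g rW + i then h (g rSrc + (a - g rW)) else h a)"
    "g' rCnt = n - i"
   and f: "same_except (mods (Blk [Load rV rSrc, Store rW rV, Add rSrc rSrc rOne, Add rW rW rOne,
     Sub rCnt rCnt rOne])) g g'"
  have "g' rOne = 1" using f assms by (simp add: same_except_def)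
  then show "reaches (Blk [Load rV rSrc, Store rW rV, Add rSrc rSrc rOne, Add rW rW rOne,
     Sub rCnt rCnt rOne]) g' h' 5 (\<lambda>g'' h''. g'' rCnt = n - Suc i \<and>
      g'' rSrc = g rSrc + Suc i \<and> g'' rW = g rW + Suc i \<and>
      h'' = (\<lambda>a. if g rW \<le> a \<and> a < g rW + Suc i then h (g rSrc + (a - g rW)) else h a))"
    using * assms by (intro reaches_Blk) (auto simp: fun_eq_iff)
qed (use assms in auto)

definition extend_rows :: com where
  "extend_rows = Repeat (Blk [Add rCnt rMM 0] ;; copy_row ;;
     Blk [Sub rZ rW rD, Store rZ rOne, Sub rI rI rOne]) rI"

lemma mods_extend_rows [simp]: "mods extend_rows = {rV, rSrc, rW, rCnt, rZ, rI}"
  by (auto simp: extend_rows_def)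

lemma reaches_extend_rows:
  assumes g: "g 0 = 0" "g rOne = 1" "g rMM = Suc m" "g rD = d" "g rI = length Cs"
    and d: "1 \<le> d" "d \<le> m" and Cs: "Cs \<noteq> []" "table m h (g rSrc) Cs"
    and le: "g rSrc + length Cs * Suc m \<le> g rW"
  shows "reaches extend_rows g h (length Cs * (6 * m + 11)) (\<lambda>g' h'.
    g' rW = g rW + length Cs * Suc m \<and> (\<forall>a. a < g rW \<or> g' rW \<le> a \<longrightarrow> h' a = h a) \<and>
    table m h' (g rW) (map (insert (Suc m - d)) Cs))"
  unfolding extend_rows_def
proof (rule reaches_count[where n = "length Cs" and T = "6 * m + 10" and
    I = "\<lambda>i g' h'. g' rSrc = g rSrc + i * Suc m \<and> g' rW = g rW + i * Suc m \<and>
      (\<forall>a. a < g rW \<or> g' rW \<le> a \<longrightarrow> h' a = h a) \<and>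
      table m h' (g rW) (map (insert (Suc m - d)) (take i Cs))"])
  fix i g1 h1
  assume i: "i < length Cs" and I: "g1 rSrc = g rSrc + i * Suc m \<and> g1 rW = g rW + i * Suc m \<and>
      (\<forall>a. a < g rW \<or> g1 rW \<le> a \<longrightarrow> h1 a = h a) \<and>
      table m h1 (g rW) (map (insert (Suc m - d)) (take i Cs))"
    and r: "g1 rI = length Cs - i"
    and f: "same_except (mods (Blk [Add rCnt rMM 0] ;; copy_row ;;
       Blk [Sub rZ rW rD, Store rZ rOne, Sub rI rI rOne])) g g1"
  have f1: "g1 0 = 0" "g1 rOne = 1" "g1 rMM = Suc m" "g1 rD = d"
    using f g by (simp_all add: same_except_def)
  have le1: "g rSrc + i * Suc m + Suc m \<le> g rW"
    using row_end[OF i, of "g rSrc" m] le by linarith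
  let ?C = "Cs ! i"
  let ?p = "g rSrc + i * Suc m"
  let ?w = "g rW + i * Suc m"
  have "row m h ?p ?C" using Cs i by (simp add: table_def)
  then have src: "row m h1 ?p ?C"
    by (rule row_cong) (use I le1 in auto)
  show "reaches (Blk [Add rCnt rMM 0] ;; copy_row ;;
      Blk [Sub rZ rW rD, Store rZ rOne, Sub rI rI rOne]) g1 h1 (6 * m + 10)
      (\<lambda>g' h'. g' rI = length Cs - Suc i \<and>
        g' rSrc = g rSrc + Suc i * Suc m \<and> g' rW = g rW + Suc i * Suc m \<and>
        (\<forall>a. a < g rW \<or> g' rW \<le> a \<longrightarrow> h' a = h a) \<and>
        table m h' (g rW) (map (insert (Suc m - d)) (take (Suc i) Cs)))"
  proof (rule reaches_Blk_Seq[where T' = "6 * m + 9"], simp only: wp.simps,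
      rule reaches_Seq[OF reaches_copy_row[where n = "Suc m"], where ?T2.0 = 3])
    fix g2 h2
    assume 2: "g2 rSrc = (g1(rCnt := g1 rMM + g1 0)) rSrc + Suc m \<and>
        g2 rW = (g1(rCnt := g1 rMM + g1 0)) rW + Suc m \<and>
        h2 = (\<lambda>a. if (g1(rCnt := g1 rMM + g1 0)) rW \<le> a \<and> a < (g1(rCnt := g1 rMM + g1 0)) rW + Suc m
           then h1 ((g1(rCnt := g1 rMM + g1 0)) rSrc + (a - (g1(rCnt := g1 rMM + g1 0)) rW)) else h1 a)"
      and f2: "same_except (mods copy_row) (g1(rCnt := g1 rMM + g1 0)) g2"
    have v2: "g2 rSrc = ?p + Suc m" "g2 rW = ?w + Suc m" "g2 rOne = 1" "g2 rD = d"
      "g2 rI = length Cs - i"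
      using 2 f2 I f1 r by (simp_all add: same_except_def)
    have h2: "h2 a = (if ?w \<le> a \<and> a < ?w + Suc m then h1 (?p + (a - ?w)) else h1 a)" for a
      using 2 I by simp
    define h3 where "h3 = h2(?w + (Suc m - d) := 1)"
    have out: "h3 a = h1 a" if "a < ?w \<or> ?w + Suc m \<le> a" for a
      using that d by (auto simp: h3_def h2)
    have "row m h3 ?w (insert (Suc m - d) ?C)"
      unfolding row_def
    proof (intro allI impI)
      fix c assume "c \<le> m"
      then have "h2 (?w + c) = of_bool (c \<in> ?C)" using src by (simp add: h2 row_def)
      then show "h3 (?w + c) = of_bool (c \<in> insert (Suc m - d) ?C)" by (simp add: h3_def)
    qed
    moreover have "table m h3 (g rW) (map (insert (Suc m - d)) (take i Cs))"
      by (rule table_cong[of m h1]) (use I i out in auto)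
    ultimately have t: "table m h3 (g rW) (map (insert (Suc m - d)) (take (Suc i) Cs))"
      using i by (simp add: take_Suc_conv_app_nth table_snoc)
    have "h2(g2 rW - g2 rD := Suc 0) = h3" using d by (simp add: h3_def v2)
    moreover have "h3 a = h a" if "a < g rW \<or> ?w + Suc m \<le> a" for a
    proof -
      have "h3 a = h1 a" using that by (intro out) auto
      then show ?thesis using I that by auto
    qed
    ultimately show "reaches (Blk [Sub rZ rW rD, Store rZ rOne, Sub rI rI rOne]) g2 h2 3
      (\<lambda>g' h'. g' rI = length Cs - Suc i \<and>
        g' rSrc = g rSrc + Suc i * Suc m \<and> g' rW = g rW + Suc i * Suc m \<and>
        (\<forall>a. a < g rW \<or> g' rW \<le> a \<longrightarrow> h' a = h a) \<and>
        table m h' (g rW) (map (insert (Suc m - d)) (take (Suc i) Cs)))"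
      using t v2 by (intro reaches_Blk) (auto simp: v2 algebra_simps)
  qed (use f1 I le1 in auto)
qed (use assms in \<open>auto simp: table_def\<close>)


definition extend_level :: com where
  "extend_level = Blk [Add rNS rW 0, Const rNC 0, Add rD rM 0] ;;
     Repeat (Blk [Add rSrc rS 0, Add rI rC 0] ;; extend_rows ;;
       Blk [Add rNC rNC rC, Sub rD rD rOne]) rD ;;
     Blk [Add rS rNS 0, Add rC rNC 0]"

lemma mods_extend_level [simp]:
  "mods extend_level = {rV, rSrc, rW, rCnt, rZ, rI, rNS, rNC, rD, rS, rC}"
  by (auto simp: extend_level_def)

definition extension :: "nat \<Rightarrow> nat set list \<Rightarrow> nat set list" where
  "extension i Cs = concat (map (\<lambda>d. map (insert d) Cs) [1..<Suc i])"

lemma extension_0 [simp]: "extension 0 Cs = []"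
  by (simp add: extension_def)

lemma extension_Suc: "extension (Suc i) Cs = extension i Cs @ map (insert (Suc i)) Cs"
  by (simp add: extension_def)

lemma length_extension [simp]: "length (extension i Cs) = i * length Cs"
  by (induction i) (auto simp: extension_Suc)

lemma table_Nil [simp]: "table m h p []"
  by (simp add: table_def)

lemma reaches_extend_level:
  assumes g: "g 0 = 0" "g rOne = 1" "g rM = m" "g rMM = Suc m" "g rC = length Cs"
    and m: "1 \<le> m" and Cs: "Cs \<noteq> []" "table m h (g rS) Cs"
    and le: "g rS + length Cs * Suc m \<le> g rW"
  shows "reaches extend_level g h (m * (length Cs * (6 * m + 11) + 5) + 5) (\<lambda>g' h'.
    g' rS = g rW \<and> g' rC = m * length Cs \<and> g' rW = g rW + m * length Cs * Suc m \<and>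
    (\<forall>a. a < g rW \<or> g' rW \<le> a \<longrightarrow> h' a = h a) \<and> table m h' (g' rS) (extension m Cs))"
  unfolding extend_level_def
proof (rule reaches_Blk_Seq[where T' = "m * (length Cs * (6 * m + 11) + 5) + 2"], simp only: wp.simps)
  let ?body = "Blk [Add rSrc rS 0, Add rI rC 0] ;; extend_rows ;; Blk [Add rNC rNC rC, Sub rD rD rOne]"
  let ?T = "length Cs * (6 * m + 11) + 4"
  define g0 where "g0 = g(rNS := g rW + g 0, rNC := 0,
    rD := (g(rNS := g rW + g 0, rNC := 0)) rM + (g(rNS := g rW + g 0, rNC := 0)) 0)"
  let ?I = "\<lambda>i g' h'. g' rNC = i * length Cs \<and> g' rW = g rW + i * length Cs * Suc m \<and>
      (\<forall>a. a < g rW \<or> g' rW \<le> a \<longrightarrow> h' a = h a) \<and> table m h' (g rW) (extension i Cs)"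
  have loop: "reaches (Repeat ?body rD) g0 h (m * Suc ?T)
     (\<lambda>g' h'. g' rS = g rS \<and> g' rNS = g rW \<and> g' 0 = 0 \<and> ?I m g' h')"
  proof (rule reaches_count[where n = m and T = ?T and I = ?I])
    show "g0 rD = m" using g by (simp add: g0_def)
    show "?I 0 g0 h" by (simp add: g0_def)
    show "\<And>g' h'. ?I m g' h' \<Longrightarrow> same_except (mods ?body) g0 g' \<Longrightarrow>
       g' rS = g rS \<and> g' rNS = g rW \<and> g' 0 = 0 \<and> ?I m g' h'"
      using g by (simp add: same_except_def g0_def)
    fix i g1 h1
    assume i: "i < m" and I: "?I i g1 h1" and r: "g1 rD = m - i"
      and f: "same_except (mods ?body) g0 g1"
    have f1: "g1 0 = 0" "g1 rOne = 1" "g1 rMM = Suc m" "g1 rC = length Cs" "g1 rS = g rS"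
      using f g by (simp_all add: same_except_def g0_def)
    let ?g = "g1(rSrc := g rS, rI := length Cs)"
    have t1: "table m h1 (g rS) Cs"
      using Cs(2) by (rule table_cong) (use I le in auto)
    have rows: "reaches extend_rows ?g h1 (length Cs * (6 * m + 11)) (\<lambda>g' h'.
        g' rW = g1 rW + length Cs * Suc m \<and> (\<forall>a. a < g1 rW \<or> g' rW \<le> a \<longrightarrow> h' a = h1 a) \<and>
        table m h' (g1 rW) (map (insert (Suc i)) Cs))"
      using reaches_extend_rows[of ?g m "m - i" Cs h1] f1 i I r Cs t1 le
      by (simp add: Suc_diff_le)
    have "reaches (extend_rows ;; Blk [Add rNC rNC rC, Sub rD rD rOne]) ?g h1
      (length Cs * (6 * m + 11) + 2) (\<lambda>g' h'. g' rD = m - Suc i \<and> ?I (Suc i) g' h')"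
    proof (rule reaches_Seq[OF rows])
      fix g2 h2
      assume 2: "g2 rW = g1 rW + length Cs * Suc m \<and> (\<forall>a. a < g1 rW \<or> g2 rW \<le> a \<longrightarrow> h2 a = h1 a) \<and>
        table m h2 (g1 rW) (map (insert (Suc i)) Cs)"
        and f2: "same_except (mods extend_rows) ?g g2"
      have v2: "g2 rNC = i * length Cs" "g2 rC = length Cs" "g2 rD = m - i" "g2 rOne = 1"
        "g2 rW = g rW + Suc i * length Cs * Suc m"
        using f2 f1 r I 2 by (simp_all add: same_except_def algebra_simps)
      have "table m h2 (g rW) (extension i Cs)"
        by (rule table_cong[of m h1]) (use I 2 in auto)
      then have t: "table m h2 (g rW) (extension (Suc i) Cs)"
        using 2 I by (simp add: extension_Suc table_append)
      have k: "h2 a = h a" if "a < g rW \<or> g2 rW \<le> a" for a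
      proof -
        have "h2 a = h1 a" using that I 2 by auto
        then show ?thesis using I 2 that by auto
      qed
      show "reaches (Blk [Add rNC rNC rC, Sub rD rD rOne]) g2 h2 2
         (\<lambda>g' h'. g' rD = m - Suc i \<and> ?I (Suc i) g' h')"
        using t k v2 by (intro reaches_Blk) simp_all
    qed simp
    then show "reaches ?body g1 h1 ?T (\<lambda>g' h'. g' rD = m - Suc i \<and> ?I (Suc i) g' h')"
      using f1 by (intro reaches_Blk_Seq[where T' = "length Cs * (6 * m + 11) + 2"]) simp_all
  qed (use m in simp_all)
  show "reaches (Repeat ?body rD ;; Blk [Add rS rNS 0, Add rC rNC 0]) g0 h
     (m * (length Cs * (6 * m + 11) + 5) + 2) (\<lambda>g' h'.
    g' rS = g rW \<and> g' rC = m * length Cs \<and> g' rW = g rW + m * length Cs * Suc m \<and>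
    (\<forall>a. a < g rW \<or> g' rW \<le> a \<longrightarrow> h' a = h a) \<and> table m h' (g' rS) (extension m Cs))"
  proof (rule reaches_Seq[OF loop, where ?T2.0 = 2], rule reaches_Blk)
  qed auto
qed simp

definition build_table :: com where
  "build_table = Blk [Add rMM rM rOne, Add rS rLen 0, Add rW rLen rMM, Const rC 1, Add rPc rK 0] ;;
     Repeat (extend_level ;; Blk [Sub rPc rPc rOne]) rPc"

lemma mods_build_table [simp]:
  "mods build_table = {rV, rSrc, rW, rCnt, rZ, rI, rNS, rNC, rD, rS, rC, rMM, rPc}"
  by (auto simp: build_table_def)

lemma level_Suc: "level m (Suc p) = extension m (level m p)"
  by (simp add: extension_def del: upt_Suc)

lemma reaches_build_table:
  assumes g: "g 0 = 0" "g rOne = 1" "g rM = m" "g rK = k" and m: "1 \<le> m" and k: "1 \<le> k"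
    and h: "\<And>a. g rLen \<le> a \<Longrightarrow> h a = 0"
  shows "reaches build_table g h (k * (m ^ k * (6 * m + 11) + 5 * m + 7) + 5) (\<lambda>g' h'.
    g' rMM = Suc m \<and> g' rC = m ^ k \<and> g rLen \<le> g' rS \<and> g' rS + m ^ k * Suc m \<le> g' rW \<and>
    (\<forall>a < g rLen. h' a = h a) \<and> (\<forall>a \<ge> g' rW. h' a = 0) \<and> table m h' (g' rS) (level m k))"
proof -
  let ?body = "extend_level ;; Blk [Sub rPc rPc rOne]"
  let ?T = "m ^ k * (6 * m + 11) + 5 * m + 6"
  let ?g = "g(rMM := Suc m, rS := g rLen, rW := g rLen + Suc m, rC := 1, rPc := k)"
  let ?I = "\<lambda>p g' h'. g' rC = m ^ p \<and> g rLen \<le> g' rS \<and> g' rS + m ^ p * Suc m \<le> g' rW \<and>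
    (\<forall>a < g rLen. h' a = h a) \<and> (\<forall>a \<ge> g' rW. h' a = 0) \<and> table m h' (g' rS) (level m p)"
  have "reaches (Repeat ?body rPc) ?g h (k * Suc ?T) (\<lambda>g' h'. g' rMM = Suc m \<and> ?I k g' h')"
  proof (rule reaches_count[where n = k and T = ?T and I = ?I])
    show "?I 0 ?g h" using h by (simp add: table_def row_def)
    show "\<And>g' h'. ?I k g' h' \<Longrightarrow> same_except (mods ?body) ?g g' \<Longrightarrow> g' rMM = Suc m \<and> ?I k g' h'"
      by (simp add: same_except_def)
    fix p g1 h1
    assume p: "p < k" and I: "?I p g1 h1" and r: "g1 rPc = k - p"
      and f: "same_except (mods ?body) ?g g1"
    have f1: "g1 0 = 0" "g1 rOne = 1" "g1 rMM = Suc m" "g1 rM = m"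
      using f g by (simp_all add: same_except_def)
    have "m * m ^ p \<le> m ^ k" using p m by (metis Suc_leI power_Suc power_increasing)
    then have "m * m ^ p * (6 * m + 11) \<le> m ^ k * (6 * m + 11)" by (rule mult_le_mono1)
    then have T: "m * (m ^ p * (6 * m + 11) + 5) + 5 + 1 \<le> ?T" by (simp add: algebra_simps)
    have "reaches extend_level g1 h1 (m * (m ^ p * (6 * m + 11) + 5) + 5) (\<lambda>g' h'.
      g' rS = g1 rW \<and> g' rC = m * m ^ p \<and> g' rW = g1 rW + m * m ^ p * Suc m \<and>
      (\<forall>a. a < g1 rW \<or> g' rW \<le> a \<longrightarrow> h' a = h1 a) \<and> table m h' (g' rS) (level m (Suc p)))"
      unfolding level_Suc
      using reaches_extend_level[of g1 m "level m p" h1] f1 I m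
      by (simp add: length_level flip: length_greater_0_conv)
    then show "reaches ?body g1 h1 ?T (\<lambda>g' h'. g' rPc = k - Suc p \<and> ?I (Suc p) g' h')"
    proof (rule reaches_Seq[OF _ _ T])
      fix g2 h2
      assume 2: "g2 rS = g1 rW \<and> g2 rC = m * m ^ p \<and> g2 rW = g1 rW + m * m ^ p * Suc m \<and>
        (\<forall>a. a < g1 rW \<or> g2 rW \<le> a \<longrightarrow> h2 a = h1 a) \<and> table m h2 (g2 rS) (level m (Suc p))"
        and f2: "same_except (mods extend_level) g1 g2"
      have v2: "g2 rPc = k - p" "g2 rOne = 1" using f2 f1 r by (simp_all add: same_except_def)
      show "reaches (Blk [Sub rPc rPc rOne]) g2 h2 1
        (\<lambda>g' h'. g' rPc = k - Suc p \<and> ?I (Suc p) g' h')"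
        using 2 I v2 by (intro reaches_Blk) (auto simp del: level.simps)
    qed
  qed (use k in simp_all)
  then show ?thesis
    unfolding build_table_def using g
    by (intro reaches_Blk_Seq[where T' = "k * Suc ?T"]) simp_all
qed

section \<open>The dynamic program\<close>

definition score_loop :: com where
  "score_loop = Repeat (Blk [Load rV rAp, Add rZ rPj rV, Load rU rZ, Add rSc rSc rU,
     Add rAp rAp rOne, Sub rCnt rCnt rOne]) rCnt"

lemma mods_score_loop [simp]: "mods score_loop = {rV, rZ, rU, rSc, rAp, rCnt}"
  by (auto simp: score_loop_def)

lemma reaches_score_loop:
  assumes "g rOne = 1" "g rCnt = n" "0 < n"
  shows "reaches score_loop g h (n * 7) (\<lambda>g' h'. h' = h \<and>
    g' rSc = g rSc + (\<Sum>a<n. h (g rPj + h (g rAp + a))))"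
  unfolding score_loop_def
proof (rule reaches_count[where n = n and T = 6 and
    I = "\<lambda>i g' h'. h' = h \<and> g' rAp = g rAp + i \<and>
      g' rSc = g rSc + (\<Sum>a<i. h (g rPj + h (g rAp + a)))"], goal_cases)
  case (4 i g' h')
  then have "g' rOne = 1" "g' rPj = g rPj" using assms by (simp_all add: same_except_def)
  with 4 show ?case by (intro reaches_Blk) simp_all
qed (use assms in auto)

definition diff_loop :: com where
  "diff_loop = Repeat (Blk [Load rU rAp, Load rV rPi, Sub rZ rU rV, Add rDiff rDiff rZ,
     Sub rZ rV rU, Add rDiff rDiff rZ, Add rAp rAp rOne, Add rPi rPi rOne, Sub rCnt rCnt rOne]) rCnt"

lemma mods_diff_loop [simp]: "mods diff_loop = {rU, rV, rZ, rDiff, rAp, rPi, rCnt}"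
  by (auto simp: diff_loop_def)

lemma reaches_diff_loop_sum:
  assumes "g rOne = 1" "g rCnt = n" "0 < n"
  shows "reaches diff_loop g h (n * 10) (\<lambda>g' h'. h' = h \<and> g' rPi = g rPi + n \<and>
    g' rDiff = g rDiff + (\<Sum>c<n. (h (g rAp + c) - h (g rPi + c)) + (h (g rPi + c) - h (g rAp + c))))"
  unfolding diff_loop_def
proof (rule reaches_count[where n = n and T = 9 and
    I = "\<lambda>i g' h'. h' = h \<and> g' rPi = g rPi + i \<and> g' rAp = g rAp + i \<and> g' rDiff = g rDiff +
      (\<Sum>c<i. (h (g rAp + c) - h (g rPi + c)) + (h (g rPi + c) - h (g rAp + c)))"], goal_cases)
  case (4 i g' h')
  then have "g' rOne = 1" using assms by (simp add: same_except_def)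
  with 4 show ?case by (intro reaches_Blk) simp_all
qed (use assms in auto)

lemma sum_row_diff:
  assumes "row m h p A" "row m h q B" "A \<subseteq> {1..m}" "B \<subseteq> {1..m}"
  shows "(\<Sum>c<Suc m. (h (p + c) - h (q + c)) + (h (q + c) - h (p + c))) = card (sym_diff A B)"
proof -
  have "(\<Sum>c<Suc m. (h (p + c) - h (q + c)) + (h (q + c) - h (p + c))) =
      (\<Sum>c<Suc m. of_bool (c \<in> sym_diff A B))"
    using assms(1,2) by (intro sum.cong) (auto simp: row_def)
  also have "\<dots> = card ({..<Suc m} \<inter> sym_diff A B)"
    by (subst sum_of_bool_eq) (auto intro!: arg_cong[where f = card])
  also have "{..<Suc m} \<inter> sym_diff A B = sym_diff A B" using assms(3,4) by auto
  finally show ?thesis .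
qed

lemma reaches_diff_loop:
  assumes "g rOne = 1" "g rCnt = Suc m" "g rDiff = 0"
    and "row m h (g rAp) A" "row m h (g rPi) B" "A \<subseteq> {1..m}" "B \<subseteq> {1..m}"
  shows "reaches diff_loop g h (Suc m * 10) (\<lambda>g' h'. h' = h \<and> g' rPi = g rPi + Suc m \<and>
    g' rDiff = card (sym_diff A B))"
  using reaches_diff_loop_sum[of g "Suc m" h] sum_row_diff[OF assms(4-7)] assms(1-3)
  by (simp del: sum.lessThan_Suc)

definition change_ok :: "bool \<Rightarrow> nat \<Rightarrow> nat \<Rightarrow> bool" where
  "change_ok cons l d \<longleftrightarrow> (if cons then d \<le> l else l \<le> d)"

definition pred_loop :: "bool \<Rightarrow> com" where
  "pred_loop cons = Repeat (Blk [Const rDiff 0, Add rAp rPj 0, Add rCnt rMM 0] ;; diff_loop ;;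
     Blk [Sub rZ (if cons then rDiff else rLim) (if cons then rLim else rDiff), Load rV rGp,
       Add rZ rZ rV, Sub rZ rOne rZ, Add rGood rGood rZ, Add rGp rGp rOne, Sub rI rI rOne]) rI"

lemma mods_pred_loop [simp]:
  "mods (pred_loop cons) = {rU, rV, rZ, rDiff, rAp, rPi, rCnt, rGood, rGp, rI}"
  by (auto simp: pred_loop_def)

lemma reaches_pred_loop:
  assumes g: "g 0 = 0" "g rOne = 1" "g rMM = Suc m" "g rI = length Cs" "g rGood = 0"
    and Cs: "Cs \<noteq> []" "\<And>B. B \<in> set Cs \<Longrightarrow> B \<subseteq> {1..m}" "table m h (g rPi) Cs"
    and A: "row m h (g rPj) A" "A \<subseteq> {1..m}"
  shows "reaches (pred_loop cons) g h (length Cs * (10 * m + 21)) (\<lambda>g' h'. h' = h \<and>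
    (0 < g' rGood \<longleftrightarrow> (\<exists>i<length Cs. h (g rGp + i) = 0 \<and>
       change_ok cons (g rLim) (card (sym_diff A (Cs ! i))))))"
  unfolding pred_loop_def
proof (rule reaches_count[where n = "length Cs" and T = "10 * m + 20" and
    I = "\<lambda>i g' h'. h' = h \<and> g' rPi = g rPi + i * Suc m \<and> g' rGp = g rGp + i \<and>
      (0 < g' rGood \<longleftrightarrow> (\<exists>j<i. h (g rGp + j) = 0 \<and>
         change_ok cons (g rLim) (card (sym_diff A (Cs ! j)))))"], goal_cases)
  case (4 i g1 h1)
  then have f1: "g1 0 = 0" "g1 rOne = 1" "g1 rMM = Suc m" "g1 rPj = g rPj" "g1 rLim = g rLim"
    using g by (simp_all add: same_except_def)
  have r: "row m h (g1 rPi) (Cs ! i)" using 4 Cs(3) by (simp add: table_def)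
  have B: "Cs ! i \<subseteq> {1..m}" using 4 Cs(2) by simp
  let ?g = "g1(rDiff := 0, rAp := g rPj, rCnt := Suc m)"
  have "reaches diff_loop ?g h (Suc m * 10) (\<lambda>g' h'. h' = h \<and> g' rPi = g1 rPi + Suc m \<and>
    g' rDiff = card (sym_diff A (Cs ! i)))"
    using reaches_diff_loop[of ?g m h A "Cs ! i"] f1 r A B by simp
  then have "reaches (diff_loop ;;
     Blk [Sub rZ (if cons then rDiff else rLim) (if cons then rLim else rDiff), Load rV rGp,
       Add rZ rZ rV, Sub rZ rOne rZ, Add rGood rGood rZ, Add rGp rGp rOne, Sub rI rI rOne])
     ?g h (Suc m * 10 + 7) (\<lambda>g' h'. g' rI = length Cs - Suc i \<and>
       h' = h \<and> g' rPi = g rPi + Suc i * Suc m \<and> g' rGp = g rGp + Suc i \<and>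
      (0 < g' rGood \<longleftrightarrow> (\<exists>j<Suc i. h (g rGp + j) = 0 \<and>
         change_ok cons (g rLim) (card (sym_diff A (Cs ! j))))))"
  proof (rule reaches_Seq[where ?T2.0 = "7"], goal_cases)
    case (1 g2 h2)
    then have f2: "g2 rOne = 1" "g2 rLim = g rLim" "g2 rGood = g1 rGood" "g2 rGp = g rGp + i"
      "g2 rI = length Cs - i" "g2 rPi = g rPi + Suc i * Suc m" "g2 rDiff = card (sym_diff A (Cs ! i))" "h2 = h"
      using f1 4 by (simp_all add: same_except_def)
    have "\<And>P. (\<exists>j<Suc i. P j) \<longleftrightarrow> (\<exists>j<i. P j) \<or> P i" by (auto simp: less_Suc_eq)
    then show ?case using f2 4(2) by (intro reaches_Blk) (auto simp: change_ok_def)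
  qed simp
  then show ?case using f1 4(2)
    by (intro reaches_Blk_Seq[where T' = "Suc m * 10 + 7"]) simp_all
qed (use assms in auto)

definition row_loop :: "bool \<Rightarrow> com" where
  "row_loop cons = Repeat (Blk [Const rSc 0, Add rAp rVp 0, Add rCnt rN 0] ;; score_loop ;;
     Blk [Sub rFail rX rSc, Const rGood 0, Add rGp rG 0, Add rPi rS 0, Add rI rC 0] ;;
     pred_loop cons ;;
     Blk [Sub rZ rOne rGood, Add rZ rZ rFail, Store rW rZ, Add rW rW rOne, Add rPj rPj rMM,
       Sub rJ rJ rOne]) rJ"

lemma mods_row_loop [simp]:
  "mods (row_loop cons) = {rU, rV, rZ, rDiff, rAp, rPi, rCnt, rGood, rGp, rI, rSc, rFail, rW, rPj, rJ}"
  by (auto simp: row_loop_def)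

lemma reaches_row_loop:
  assumes g: "g 0 = 0" "g rOne = 1" "g rMM = Suc m" "g rC = length Cs" "g rJ = length Cs" "g rN = n"
      "g rPj = g rS" and n: "0 < n"
    and Cs: "Cs \<noteq> []" "\<And>B. B \<in> set Cs \<Longrightarrow> B \<subseteq> {1..m}" "table m h (g rS) Cs"
    and le: "g rS + length Cs * Suc m \<le> g rW" "g rG + length Cs \<le> g rW" "g rVp + n \<le> g rW"
    and v: "\<And>a. a < n \<Longrightarrow> h (g rVp + a) \<le> m"
  shows "reaches (row_loop cons) g h (length Cs * (length Cs * (10 * m + 21) + 7 * n + 15)) (\<lambda>g' h'.
    g' rW = g rW + length Cs \<and> (\<forall>a<g rW. h' a = h a) \<and>
    (\<forall>j<length Cs. h' (g rW + j) = 0 \<longleftrightarrow> g rX \<le> card {a. a < n \<and> h (g rVp + a) \<in> Cs ! j} \<and>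
       (\<exists>i<length Cs. h (g rG + i) = 0 \<and> change_ok cons (g rLim) (card (sym_diff (Cs ! j) (Cs ! i))))))"
  unfolding row_loop_def
proof (rule reaches_count[where n = "length Cs" and T = "length Cs * (10 * m + 21) + 7 * n + 14" and
    I = "\<lambda>i g' h'. g' rPj = g rS + i * Suc m \<and> g' rW = g rW + i \<and> (\<forall>a<g rW. h' a = h a) \<and>
    (\<forall>j<i. h' (g rW + j) = 0 \<longleftrightarrow> g rX \<le> card {a. a < n \<and> h (g rVp + a) \<in> Cs ! j} \<and>
       (\<exists>i<length Cs. h (g rG + i) = 0 \<and> change_ok cons (g rLim) (card (sym_diff (Cs ! j) (Cs ! i)))))"], goal_cases)
  case (4 i g1 h1)
  let ?A = "Cs ! i"
  from 4 have f1: "g1 0 = 0" "g1 rOne = 1" "g1 rMM = Suc m" "g1 rC = length Cs" "g1 rN = n"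
      "g1 rLim = g rLim" "g1 rS = g rS" "g1 rG = g rG" "g1 rVp = g rVp" "g1 rX = g rX"
    using g by (simp_all add: same_except_def)
  have t1: "table m h1 (g rS) Cs" using Cs(3) by (rule table_cong) (use 4 le in auto)
  then have r: "row m h1 (g1 rPj) ?A" using 4 by (simp add: table_def)
  have B: "?A \<subseteq> {1..m}" using 4 Cs(2) by simp
  have vp: "h1 (g rVp + a) = h (g rVp + a)" if "a < n" for a using 4 le that by auto
  have hG: "h1 (g rG + a) = h (g rG + a)" if "a < length Cs" for a using 4 le that by auto
  have "(\<Sum>a<n. h1 (g1 rPj + h1 (g rVp + a))) = (\<Sum>a<n. of_bool (h (g rVp + a) \<in> ?A))"
    using r v by (intro sum.cong) (auto simp: row_def vp)
  also have "\<dots> = card {a. a < n \<and> h (g rVp + a) \<in> ?A}"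
    by (subst sum_of_bool_eq) (auto intro!: arg_cong[where f = card])
  finally have sc: "(\<Sum>a<n. h1 (g1 rPj + h1 (g rVp + a))) = card {a. a < n \<and> h (g rVp + a) \<in> ?A}" .
  let ?g = "g1(rSc := 0, rAp := g rVp, rCnt := n)"
  let ?Q = "\<lambda>g' h'. g' rJ = length Cs - Suc i \<and>
      g' rPj = g rS + Suc i * Suc m \<and> g' rW = g rW + Suc i \<and> (\<forall>a<g rW. h' a = h a) \<and>
    (\<forall>j<Suc i. h' (g rW + j) = 0 \<longleftrightarrow> g rX \<le> card {a. a < n \<and> h (g rVp + a) \<in> Cs ! j} \<and>
       (\<exists>i<length Cs. h (g rG + i) = 0 \<and> change_ok cons (g rLim) (card (sym_diff (Cs ! j) (Cs ! i)))))"
  have "reaches score_loop ?g h1 (n * 7) (\<lambda>g' h'. h' = h1 \<and>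
      g' rSc = card {a. a < n \<and> h (g rVp + a) \<in> ?A})"
    using reaches_score_loop[of ?g n h1] f1 n sc by simp
  then have "reaches (score_loop ;;
     Blk [Sub rFail rX rSc, Const rGood 0, Add rGp rG 0, Add rPi rS 0, Add rI rC 0] ;;
     pred_loop cons ;;
     Blk [Sub rZ rOne rGood, Add rZ rZ rFail, Store rW rZ, Add rW rW rOne, Add rPj rPj rMM,
       Sub rJ rJ rOne]) ?g h1 (n * 7 + (length Cs * (10 * m + 21) + 11)) ?Q"
  proof (rule reaches_Seq[where ?T2.0 = "length Cs * (10 * m + 21) + 11"], goal_cases)
    case (1 g2 h2)
    then have f2: "g2 0 = 0" "g2 rOne = 1" "g2 rMM = Suc m" "g2 rC = length Cs"
      "g2 rLim = g rLim" "g2 rS = g rS" "g2 rG = g rG" "g2 rX = g rX" "h2 = h1"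
      "g2 rSc = card {a. a < n \<and> h (g rVp + a) \<in> ?A}" "g2 rPj = g1 rPj" "g2 rW = g1 rW" "g2 rJ = g1 rJ"
      using f1 by (simp_all add: same_except_def)
    let ?g2 = "g2(rFail := g rX - g2 rSc, rGood := 0, rGp := g rG, rPi := g rS, rI := length Cs)"
    have "reaches (pred_loop cons) ?g2 h1 (length Cs * (10 * m + 21)) (\<lambda>g' h'. h' = h1 \<and>
      (0 < g' rGood \<longleftrightarrow> (\<exists>i<length Cs. h (g rG + i) = 0 \<and>
        change_ok cons (g rLim) (card (sym_diff ?A (Cs ! i))))))"
      using reaches_pred_loop[of ?g2 m Cs h1 ?A cons] f2 Cs(1,2) t1 r B hG by (simp cong: conj_cong)
    then have "reaches (pred_loop cons ;;
       Blk [Sub rZ rOne rGood, Add rZ rZ rFail, Store rW rZ, Add rW rW rOne, Add rPj rPj rMM,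
       Sub rJ rJ rOne]) ?g2 h1 (length Cs * (10 * m + 21) + 6) ?Q"
    proof (rule reaches_Seq[where ?T2.0 = "6"], goal_cases)
      case (1 g3 h3)
      then have f3: "g3 rOne = 1" "g3 rMM = Suc m" "g3 rW = g rW + i" "g3 rPj = g rS + i * Suc m"
        "g3 rJ = length Cs - i" "h3 = h1" "g3 rFail = g rX - card {a. a < n \<and> h (g rVp + a) \<in> ?A}"
        "0 < g3 rGood \<longleftrightarrow> (\<exists>i<length Cs. h (g rG + i) = 0 \<and>
          change_ok cons (g rLim) (card (sym_diff ?A (Cs ! i))))"
        using f2 4 by (simp_all add: same_except_def)
      have "Suc 0 - g3 rGood = 0 \<longleftrightarrow> (\<exists>i<length Cs. h (g rG + i) = 0 \<and>
          change_ok cons (g rLim) (card (sym_diff ?A (Cs ! i))))"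
        unfolding f3(8)[symmetric] by linarith
      then show ?case using f3(1-7) 4(2) by (intro reaches_Blk) (auto simp: less_Suc_eq)
    qed simp
    then show ?case using f2
      by (intro reaches_Blk_Seq[where T' = "length Cs * (10 * m + 21) + 6"]) simp_all
  qed simp
  then show ?case using f1
    by (intro reaches_Blk_Seq[where T' = "n * 7 + (length Cs * (10 * m + 21) + 11)"]) simp_all
qed (use assms in auto)

lemma bex_set_nth: "(\<exists>x\<in>set xs. P x) \<longleftrightarrow> (\<exists>i<length xs. P (xs ! i))"
  by (metis in_set_conv_nth)

fun feasible ::
  "bool \<Rightarrow> nat \<Rightarrow> nat set set \<Rightarrow> (nat \<Rightarrow> nat set \<Rightarrow> bool) \<Rightarrow> nat \<Rightarrow> nat set \<Rightarrow> bool" where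
  "feasible cons l \<C> ok 0 C \<longleftrightarrow> True"
| "feasible cons l \<C> ok (Suc t) C \<longleftrightarrow> ok (Suc t) C \<and>
     (\<exists>B\<in>\<C>. feasible cons l \<C> ok t B \<and> (t = 0 \<or> change_ok cons l (card (sym_diff C B))))"

text \<open>
  In a row of the dynamic program the cell of a feasible committee is zero. Row 0, in which all
  committees are feasible, is then just fresh memory, and the limit register initially holds a value
  that makes the comparison with its entries succeed.
\<close>

definition dp_loop :: "bool \<Rightarrow> com" where
  "dp_loop cons = Repeat (Blk [Add rNG rW 0, Add rPj rS 0, Add rJ rC 0] ;; row_loop cons ;;
     Blk [Add rG rNG 0, Add rVp rVp rN, Add rLim rL 0, Sub rT rT rOne]) rT"

lemma mods_dp_loop [simp]:
  "mods (dp_loop cons) = {rU, rV, rZ, rDiff, rAp, rPi, rCnt, rGood, rGp, rI, rSc, rFail, rW, rPj, rJ,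
     rNG, rG, rVp, rLim, rT}"
  by (auto simp: dp_loop_def)

lemma reaches_dp_loop:
  assumes g: "g 0 = 0" "g rOne = 1" "g rMM = Suc m" "g rC = length Cs" "g rN = n" "g rT = \<tau>"
      "g rLim = (if cons then m else 0)"
    and n: "0 < n" and \<tau>: "0 < \<tau>"
    and Cs: "Cs \<noteq> []" "\<And>B. B \<in> set Cs \<Longrightarrow> B \<subseteq> {1..m}" "table m h (g rS) Cs"
    and le: "g rS + length Cs * Suc m \<le> g rG" "g rVp + \<tau> * n \<le> g rG" "g rG + length Cs \<le> g rW"
    and v: "\<And>t a. t < \<tau> \<Longrightarrow> a < n \<Longrightarrow> h (g rVp + t * n + a) \<le> m"
    and ok: "\<And>t C. t < \<tau> \<Longrightarrow> C \<in> set Cs \<Longrightarrow>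
      ok (Suc t) C \<longleftrightarrow> g rX \<le> card {a. a < n \<and> h (g rVp + t * n + a) \<in> C}"
    and zero: "\<And>j. j < length Cs \<Longrightarrow> h (g rG + j) = 0"
  shows "reaches (dp_loop cons) g h
    (\<tau> * (length Cs * (length Cs * (10 * m + 21) + 7 * n + 15) + 8)) (\<lambda>g' h'.
    (\<forall>j<length Cs. h' (g' rG + j) = 0 \<longleftrightarrow> feasible cons (g rL) (set Cs) ok \<tau> (Cs ! j)))"
  unfolding dp_loop_def
proof (rule reaches_count[where n = \<tau> and
    T = "length Cs * (length Cs * (10 * m + 21) + 7 * n + 15) + 7" and
    I = "\<lambda>t g' h'. g rG \<le> g' rG \<and> g' rG + length Cs \<le> g' rW \<and> (\<forall>a<g rG. h' a = h a) \<and>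
      g' rVp = g rVp + t * n \<and> g' rLim = (if t = 0 then g rLim else g rL) \<and>
      (\<forall>j<length Cs. h' (g' rG + j) = 0 \<longleftrightarrow> feasible cons (g rL) (set Cs) ok t (Cs ! j))"], goal_cases)
  case (4 t g1 h1)
  let ?N = "length Cs"
  let ?T = "?N * (?N * (10 * m + 21) + 7 * n + 15)"
  from 4 have f1: "g1 0 = 0" "g1 rOne = 1" "g1 rMM = Suc m" "g1 rC = ?N" "g1 rN = n"
      "g1 rS = g rS" "g1 rX = g rX" "g1 rL = g rL"
    using g by (simp_all add: same_except_def)
  have t1: "table m h1 (g rS) Cs" using Cs(3) by (rule table_cong) (use 4 le in auto)
  have tn: "t * n + n \<le> \<tau> * n" using 4(1) mult_le_mono1[of "Suc t" \<tau> n] by simp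
  have vp: "h1 (g1 rVp + a) = h (g rVp + t * n + a)" if "a < n" for a
    using 4 le(2) that tn by (auto simp: add.assoc)
  let ?g = "g1(rNG := g1 rW, rPj := g rS, rJ := ?N)"
  have eqv: "{a. a < n \<and> h1 (g1 rVp + a) \<in> C} = {a. a < n \<and> h (g rVp + t * n + a) \<in> C}" for C
    using vp by auto
  have "reaches (row_loop cons) ?g h1 ?T (\<lambda>g' h'.
    g' rW = g1 rW + ?N \<and> (\<forall>a<g1 rW. h' a = h1 a) \<and>
    (\<forall>j<?N. h' (g1 rW + j) = 0 \<longleftrightarrow> g rX \<le> card {a. a < n \<and> h1 (g1 rVp + a) \<in> Cs ! j} \<and>
       (\<exists>i<?N. h1 (g1 rG + i) = 0 \<and> change_ok cons (g1 rLim) (card (sym_diff (Cs ! j) (Cs ! i))))))"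
    using reaches_row_loop[of ?g m Cs n h1 cons] f1 n Cs(1,2) t1 4 le vp v[of t] tn by simp
  then have "reaches (row_loop cons ;;
      Blk [Add rG rNG 0, Add rVp rVp rN, Add rLim rL 0, Sub rT rT rOne]) ?g h1 (?T + 4)
    (\<lambda>g' h'. g' rT = \<tau> - Suc t \<and>
      g rG \<le> g' rG \<and> g' rG + length Cs \<le> g' rW \<and> (\<forall>a<g rG. h' a = h a) \<and>
      g' rVp = g rVp + Suc t * n \<and> g' rLim = (if Suc t = 0 then g rLim else g rL) \<and>
      (\<forall>j<length Cs. h' (g' rG + j) = 0 \<longleftrightarrow> feasible cons (g rL) (set Cs) ok (Suc t) (Cs ! j)))"
  proof (rule reaches_Seq[where ?T2.0 = "4"], goal_cases)
    case (1 g2 h2)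
    then have f2: "g2 0 = 0" "g2 rOne = 1" "g2 rN = n" "g2 rL = g rL" "g2 rNG = g1 rW"
      "g2 rVp = g rVp + t * n" "g2 rT = \<tau> - t"
      using f1 4 by (simp_all add: same_except_def)
    have "h2 (g1 rW + j) = 0 \<longleftrightarrow> feasible cons (g rL) (set Cs) ok (Suc t) (Cs ! j)"
      if j: "j < ?N" for j
    proof -
      have lim: "change_ok cons (g1 rLim) (card (sym_diff (Cs ! j) B)) \<longleftrightarrow>
        t = 0 \<or> change_ok cons (g rL) (card (sym_diff (Cs ! j) B))" if "B \<in> set Cs" for B
      proof (cases "t = 0")
        case True
        have "sym_diff (Cs ! j) B \<subseteq> {1..m}" using Cs(2)[of B] Cs(2)[of "Cs ! j"] that j by auto
        then have "card (sym_diff (Cs ! j) B) \<le> m" using card_mono[of "{1..m}"] by fastforce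
        then show ?thesis using True 4 g by (simp add: change_ok_def)
      qed (use 4 in simp)
      have "h2 (g1 rW + j) = 0 \<longleftrightarrow> g rX \<le> card {a. a < n \<and> h1 (g1 rVp + a) \<in> Cs ! j} \<and>
       (\<exists>i<?N. h1 (g1 rG + i) = 0 \<and> change_ok cons (g1 rLim) (card (sym_diff (Cs ! j) (Cs ! i))))"
        using 1 j by blast
      also have "\<dots> \<longleftrightarrow> ok (Suc t) (Cs ! j) \<and>
       (\<exists>i<?N. feasible cons (g rL) (set Cs) ok t (Cs ! i) \<and>
         (t = 0 \<or> change_ok cons (g rL) (card (sym_diff (Cs ! j) (Cs ! i)))))"
        unfolding eqv using ok[OF 4(1), of "Cs ! j"] j 4(2) lim by (simp cong: conj_cong)
      also have "\<dots> \<longleftrightarrow> feasible cons (g rL) (set Cs) ok (Suc t) (Cs ! j)"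
        by (simp add: bex_set_nth)
      finally show ?thesis .
    qed
    with f2 4(2) 1 show ?case by (intro reaches_Blk) (simp_all del: feasible.simps)
  qed simp
  then show ?case using f1
    by (intro reaches_Blk_Seq[where T' = "?T + 4"]) (simp_all del: feasible.simps)
qed (use assms in auto)

definition exists_zero :: com where
  "exists_zero = Blk [Const rGood 0, Add rCnt rC 0] ;;
     Repeat (Blk [Load rV rG, Sub rZ rOne rV, Add rGood rGood rZ, Add rG rG rOne, Sub rCnt rCnt rOne]) rCnt ;;
     Blk [Sub rZ rOne rGood, Sub 0 rOne rZ]"

lemma reaches_exists_zero:
  assumes g: "g 0 = 0" "g rOne = 1" "g rC = N" and N: "0 < N"
  shows "reaches exists_zero g h (N * 6 + 4) (\<lambda>g' h'. g' 0 = of_bool (\<exists>j<N. h (g rG + j) = 0))"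
proof -
  let ?g = "g(rGood := 0, rCnt := N)"
  let ?body = "Blk [Load rV rG, Sub rZ rOne rV, Add rGood rGood rZ, Add rG rG rOne, Sub rCnt rCnt rOne]"
  have "reaches (Repeat ?body rCnt) ?g h (N * 6) (\<lambda>g' h'. g' rOne = 1 \<and>
      (0 < g' rGood \<longleftrightarrow> (\<exists>j<N. h (g rG + j) = 0)))"
  proof (rule reaches_count[where n = N and T = 5 and
      I = "\<lambda>i g' h'. h' = h \<and> g' rG = g rG + i \<and> (0 < g' rGood \<longleftrightarrow> (\<exists>j<i. h (g rG + j) = 0))"], goal_cases)
    case (4 i g' h')
    then have "g' rOne = 1" using g by (simp add: same_except_def)
    with 4 show ?case by (intro reaches_Blk) (auto simp: less_Suc_eq)
  qed (use assms in \<open>auto simp: same_except_def\<close>)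
  then have "reaches (Repeat ?body rCnt ;; Blk [Sub rZ rOne rGood, Sub 0 rOne rZ]) ?g h (N * 6 + 2)
      (\<lambda>g' h'. g' 0 = of_bool (\<exists>j<N. h (g rG + j) = 0))"
    by (rule reaches_Seq) (rule reaches_Blk, auto)
  then show ?thesis unfolding exists_zero_def using g
    by (intro reaches_Blk_Seq[where T' = "N * 6 + 2"]) simp_all
qed

definition solve :: "bool \<Rightarrow> com" where
  "solve cons = build_table ;;
     Blk [Add rG rW 0, Add rW rW rC, Const rVp 6, Add rVp rVp rM, Add rLim (if cons then rM else 0) 0,
       Add rT rTau 0] ;;
     dp_loop cons ;; exists_zero"

lemma reaches_solve:
  assumes g: "g 0 = 0" "g rOne = 1" "g rM = m" "g rK = k" "g rN = n" "g rTau = \<tau>"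
    and pos: "1 \<le> m" "1 \<le> k" "0 < n" "0 < \<tau>"
    and len: "g rLen = 6 + m + \<tau> * n" "\<And>a. g rLen \<le> a \<Longrightarrow> h a = 0"
    and v: "\<And>t a. t < \<tau> \<Longrightarrow> a < n \<Longrightarrow> h (6 + m + t * n + a) \<le> m"
    and ok: "\<And>t C. t < \<tau> \<Longrightarrow> C \<in> set (level m k) \<Longrightarrow>
      ok (Suc t) C \<longleftrightarrow> g rX \<le> card {a. a < n \<and> h (6 + m + t * n + a) \<in> C}"
  shows "reaches (solve cons) g h
    ((k * (m ^ k * (6 * m + 11) + 5 * m + 7) + 5) + (6 +
     (\<tau> * (m ^ k * (m ^ k * (10 * m + 21) + 7 * n + 15) + 8) + (m ^ k * 6 + 4))))
    (\<lambda>g' h'. g' 0 = of_bool (\<exists>C \<in> set (level m k). feasible cons (g rL) (set (level m k)) ok \<tau> C))"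
  unfolding solve_def
proof (rule reaches_Seq[OF reaches_build_table[where m = m and k = k],
    where ?T2.0 = "6 + (\<tau> * (m ^ k * (m ^ k * (10 * m + 21) + 7 * n + 15) + 8) + (m ^ k * 6 + 4))"], goal_cases)
  case (8 g1 h1)
  let ?Cs = "level m k"
  from 8 have f1: "g1 0 = 0" "g1 rOne = 1" "g1 rM = m" "g1 rN = n" "g1 rTau = \<tau>" "g1 rL = g rL"
    "g1 rX = g rX"
    using g by (simp_all add: same_except_def)
  have Cs: "?Cs \<noteq> []" "\<And>B. B \<in> set ?Cs \<Longrightarrow> B \<subseteq> {1..m}"
    using pos length_level[of m k] by (force, simp add: set_level)
  have h1: "h1 (6 + m + t * n + a) = h (6 + m + t * n + a)" if "t < \<tau>" "a < n" for t a
  proof -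
    have "t * n + a < \<tau> * n" using that mult_le_mono1[of "Suc t" \<tau> n] by simp
    then show ?thesis using 8 len by simp
  qed
  have eqv: "{a. a < n \<and> h1 (6 + m + t * n + a) \<in> C} = {a. a < n \<and> h (6 + m + t * n + a) \<in> C}"
    if "t < \<tau>" for t C using h1 that by auto
  let ?g = "g1(rG := g1 rW, rW := g1 rW + m ^ k, rVp := 6 + m, rLim := if cons then m else 0, rT := \<tau>)"
  let ?T = "\<tau> * (m ^ k * (m ^ k * (10 * m + 21) + 7 * n + 15) + 8)"
  have "reaches (dp_loop cons) ?g h1 ?T (\<lambda>g' h'.
    (\<forall>j<m ^ k. h' (g' rG + j) = 0 \<longleftrightarrow> feasible cons (g rL) (set ?Cs) ok \<tau> (?Cs ! j)))"
    using reaches_dp_loop[of ?g m ?Cs n \<tau> cons h1 ok] f1 8 pos Cs len(1) v ok h1 eqv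
    by (simp add: length_level)
  then have "reaches (dp_loop cons ;; exists_zero) ?g h1 (?T + (m ^ k * 6 + 4))
    (\<lambda>g' h'. g' 0 = of_bool (\<exists>C \<in> set ?Cs. feasible cons (g rL) (set ?Cs) ok \<tau> C))"
  proof (rule reaches_Seq[where ?T2.0 = "m ^ k * 6 + 4"], goal_cases)
    case (1 g2 h2)
    have E: "(\<exists>C \<in> set ?Cs. feasible cons (g rL) (set ?Cs) ok \<tau> C) \<longleftrightarrow>
        (\<exists>j<m ^ k. h2 (g2 rG + j) = 0)"
      using 1 by (simp add: bex_set_nth length_level cong: conj_cong)
    show ?case unfolding E
      by (rule reaches_exists_zero) (use 1 8 f1 pos in \<open>simp_all add: same_except_def\<close>)
  qed simp
  then show ?case using f1 8
    by (intro reaches_Blk_Seq[where T' = "?T + (m ^ k * 6 + 4)"]; cases cons; simp)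
qed (use assms in auto)

section \<open>Validating the input\<close>

definition load_input :: com where
  "load_input = Blk [Const rZ 0, Add rLen 0 rZ, Const 0 0, Const rOne 1,
     Const rP 0, Load rK rP, Const rP 1, Load rL rP, Const rP 2, Load rX rP, Const rP 3, Load rN rP,
     Const rP 4, Load rM rP, Const rP 5, Load rTau rP, Const rP 6,
     Sub rB rOne rK, Sub rZ rOne rX, Add rB rB rZ, Sub rZ rOne rN, Add rB rB rZ,
     Sub rZ rOne rM, Add rB rB rZ, Sub rZ rOne rTau, Add rB rB rZ]"

lemma reaches_load_input:
  "reaches load_input ((\<lambda>_. 0)(0 := len)) h 26 (\<lambda>g h'. h' = h \<and> g 0 = 0 \<and> g rOne = 1 \<and>
     g rLen = len \<and> g rK = h 0 \<and> g rL = h 1 \<and> g rX = h 2 \<and> g rN = h 3 \<and> g rM = h 4 \<and> g rTau = h 5 \<and>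
     g rP = 6 \<and> (g rB = 0 \<longleftrightarrow> 1 \<le> h 0 \<and> 1 \<le> h 2 \<and> 1 \<le> h 3 \<and> 1 \<le> h 4 \<and> 1 \<le> h 5))"
  unfolding load_input_def by (rule reaches_Blk) auto

definition check_length :: com where
  "check_length = Unless rB (Blk [Add rZ rP rM, Sub rB rZ rLen])"

lemma mods_check_length [simp]: "mods check_length = {rB, rZ}"
  by (auto simp: check_length_def)

lemma reaches_check_length:
  "reaches check_length g h 3 (\<lambda>g' h'. h' = h \<and>
     (g' rB = 0 \<longleftrightarrow> g rB = 0 \<and> g rP + g rM \<le> g rLen))"
  unfolding check_length_def
  by (rule reaches_Unless[where T = 2], rule reaches_Blk) auto

definition check_cands :: com where
  "check_cands = Unless rB (Blk [Add rCnt rM 0, Const rU 1] ;;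
     Repeat (Blk [Load rV rP, Sub rZ rV rU, Add rB rB rZ, Sub rZ rU rV, Add rB rB rZ,
       Add rU rU rOne, Add rP rP rOne, Sub rCnt rCnt rOne]) rCnt)"

lemma mods_check_cands [simp]: "mods check_cands = {rV, rZ, rB, rU, rP, rCnt}"
  by (auto simp: check_cands_def)

lemma reaches_check_cands:
  assumes g: "g 0 = 0" "g rOne = 1" and m: "g rB = 0 \<Longrightarrow> 0 < g rM \<and> g rM \<le> n"
  shows "reaches check_cands g h (9 * n + 3) (\<lambda>g' h'. h' = h \<and>
     (g' rB = 0 \<longleftrightarrow> g rB = 0 \<and> (\<forall>c<g rM. h (g rP + c) = Suc c)) \<and>
     (g' rB = 0 \<longrightarrow> g' rP = g rP + g rM))"
  unfolding check_cands_def
proof (rule reaches_Unless[where T = "9 * n + 2"], goal_cases)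
  case 1
  let ?g = "g(rCnt := g rM, rU := 1)"
  have "reaches (Repeat (Blk [Load rV rP, Sub rZ rV rU, Add rB rB rZ, Sub rZ rU rV, Add rB rB rZ,
       Add rU rU rOne, Add rP rP rOne, Sub rCnt rCnt rOne]) rCnt) ?g h (9 * n)
     (\<lambda>g' h'. h' = h \<and> (g' rB = 0 \<longleftrightarrow> (\<forall>c<g rM. h (g rP + c) = Suc c)) \<and>
       (g' rB = 0 \<longrightarrow> g' rP = g rP + g rM))"
  proof (rule reaches_count[where n = "g rM" and T = 8 and
      I = "\<lambda>i g' h'. h' = h \<and> (g' rB = 0 \<longleftrightarrow> (\<forall>c<i. h (g rP + c) = Suc c)) \<and> g' rP = g rP + i \<and>
        g' rU = Suc i"], goal_cases)
    case (4 i g' h')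
    then have "g' rOne = 1" using g by (simp add: same_except_def)
    with 4 show ?case by (intro reaches_Blk) (auto simp: less_Suc_eq)
  qed (use 1 m in auto)
  then show ?case using g 1 by (intro reaches_Blk_Seq[where T' = "9 * n"]) simp_all
qed auto

definition check_count :: com where
  "check_count = Unless rB (Blk [Sub rI rLen rP, Const rSc 0, Const rC 0] ;;
     Repeat (Blk [Add rSc rSc rN, Add rC rC rOne, Sub rZ rI rSc]) rZ ;;
     Blk [Sub rB rSc rI, Sub rZ rC rTau, Add rB rB rZ, Sub rZ rTau rC, Add rB rB rZ])"

lemma mods_check_count [simp]: "mods check_count = {rI, rSc, rC, rZ, rB}"
  by (auto simp: check_count_def)

text \<open>
  The loop adds up rows until the number \<open>R\<close> of vote cells is reached. Counting up to \<open>\<tau>\<close> instead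
  would not be polynomial in the length of an invalid input.
\<close>

lemma reaches_check_count:
  assumes g: "g rOne = 1" and pos: "g rB = 0 \<Longrightarrow> 0 < g rN \<and> 0 < g rTau"
  shows "reaches check_count g h (4 * g rLen + 13) (\<lambda>g' h'. h' = h \<and>
     (g' rB = 0 \<longleftrightarrow> g rB = 0 \<and> g rLen - g rP = g rTau * g rN))"
  unfolding check_count_def
proof (rule reaches_Unless[where T = "4 * g rLen + 12"], goal_cases)
  case 1
  define R where "R = g rLen - g rP"
  define n where "n = g rN"
  define t where "t = g rTau"
  have nt: "0 < n" "0 < t" using pos 1 by (simp_all add: n_def t_def)
  let ?g = "g(rI := R, rSc := 0, rC := 0)"
  let ?Q = "\<lambda>g' h'. h' = h \<and> (\<exists>q. g' rC = Suc q \<and> g' rSc = Suc q * n \<and> R \<le> Suc q * n \<and> (q * n < R \<or> q = 0))"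
  have loop: "reaches (Repeat (Blk [Add rSc rSc rN, Add rC rC rOne, Sub rZ rI rSc]) rZ) ?g h
     (4 * g rLen + 4) (\<lambda>g' h'. ?Q g' h' \<and> g' rI = R \<and> g' rTau = t)"
  proof (rule reaches_conseq)
    show "reaches (Repeat (Blk [Add rSc rSc rN, Add rC rC rOne, Sub rZ rI rSc]) rZ) ?g h
     (4 * g rLen + 4) ?Q"
    proof (rule reaches_Repeat[where n = "Suc R" and T = 3 and
       I = "\<lambda>j g' h'. h' = h \<and> (\<exists>q. g' rC = q \<and> g' rSc = q * n \<and> R < q * n + j \<and> (q * n < R \<or> q = 0))"], goal_cases)
      case (3 j g' h')
      then obtain q where q: "h' = h" "g' rC = q" "g' rSc = q * n" "R < q * n + Suc j" "q * n < R \<or> q = 0"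
        by blast
      have "g' rOne = 1" "g' rN = n" "g' rI = R" using 3 g by (simp_all add: same_except_def n_def)
      with q nt show ?case
        by (intro reaches_Blk) (auto intro!: exI[of _ q])
    qed (auto simp: R_def)
  qed (auto simp: same_except_def t_def)
  have "reaches (Repeat (Blk [Add rSc rSc rN, Add rC rC rOne, Sub rZ rI rSc]) rZ ;;
     Blk [Sub rB rSc rI, Sub rZ rC rTau, Add rB rB rZ, Sub rZ rTau rC, Add rB rB rZ]) ?g h
     (4 * g rLen + 9) (\<lambda>g' h'. h' = h \<and> (g' rB = 0 \<longleftrightarrow> R = t * n))"
  proof (rule reaches_Seq[OF loop, where ?T2.0 = 5], goal_cases)
    case (1 g' h')
    then obtain q where q: "h' = h" "g' rC = Suc q" "g' rSc = Suc q * n" "R \<le> Suc q * n"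
      "q * n < R \<or> q = 0" "g' rI = R" "g' rTau = t" by blast
    have "Suc q * n - R = 0 \<and> Suc q - t = 0 \<and> t - Suc q = 0 \<longleftrightarrow> R = t * n"
    proof
      assume "R = t * n"
      then have "t \<le> Suc q" using q(4) nt by (metis mult_le_cancel2)
      moreover have "q < t" using q(5) \<open>R = t * n\<close> nt by auto
      ultimately have "t = Suc q" by simp
      with \<open>R = t * n\<close> show "Suc q * n - R = 0 \<and> Suc q - t = 0 \<and> t - Suc q = 0" by simp
    next
      assume "Suc q * n - R = 0 \<and> Suc q - t = 0 \<and> t - Suc q = 0"
      then have "t = Suc q" "Suc q * n \<le> R" by auto
      then show "R = t * n" using q(4) by simp
    qed
    with q(1-3,6,7) show ?case by (intro reaches_Blk) auto
  qed simp
  then show ?case using 1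
    by (intro reaches_Blk_Seq[where T' = "4 * g rLen + 9"]) (simp_all add: R_def n_def t_def)
qed auto

definition check_votes :: com where
  "check_votes = Unless rB (Blk [Sub rCnt rLen rP] ;;
     Repeat (Blk [Load rV rP, Sub rZ rV rM, Add rB rB rZ, Add rP rP rOne, Sub rCnt rCnt rOne]) rCnt)"

lemma mods_check_votes [simp]: "mods check_votes = {rV, rZ, rB, rP, rCnt}"
  by (auto simp: check_votes_def)

lemma reaches_check_votes:
  assumes g: "g rOne = 1" and pos: "g rB = 0 \<Longrightarrow> g rP < g rLen"
  shows "reaches check_votes g h (6 * g rLen + 2) (\<lambda>g' h'. h' = h \<and>
     (g' rB = 0 \<longleftrightarrow> g rB = 0 \<and> (\<forall>i<g rLen - g rP. h (g rP + i) \<le> g rM)))"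
  unfolding check_votes_def
proof (rule reaches_Unless[where T = "6 * g rLen + 1"], goal_cases)
  case 1
  let ?R = "g rLen - g rP"
  let ?g = "g(rCnt := ?R)"
  have "reaches (Repeat (Blk [Load rV rP, Sub rZ rV rM, Add rB rB rZ, Add rP rP rOne, Sub rCnt rCnt rOne])
      rCnt) ?g h (6 * g rLen) (\<lambda>g' h'. h' = h \<and> (g' rB = 0 \<longleftrightarrow> (\<forall>i<?R. h (g rP + i) \<le> g rM)))"
  proof (rule reaches_count[where n = ?R and T = 5 and
      I = "\<lambda>i g' h'. h' = h \<and> (g' rB = 0 \<longleftrightarrow> (\<forall>j<i. h (g rP + j) \<le> g rM)) \<and> g' rP = g rP + i"], goal_cases)
    case (4 i g' h')
    then have "g' rOne = 1" "g' rM = g rM" using g by (simp_all add: same_except_def)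
    with 4 show ?case by (intro reaches_Blk) (auto simp: less_Suc_eq)
  qed (use 1 pos in auto)
  then show ?case using g 1 by (intro reaches_Blk_Seq[where T' = "6 * g rLen"]) simp_all
qed auto

definition validate :: com where
  "validate = load_input ;; check_length ;; check_cands ;; check_count ;; check_votes"

definition well_formed :: "nat \<Rightarrow> store \<Rightarrow> bool" where
  "well_formed len h \<longleftrightarrow>
     (1 \<le> h 0 \<and> 1 \<le> h 2 \<and> 1 \<le> h 3 \<and> 1 \<le> h 4 \<and> 1 \<le> h 5) \<and> 6 + h 4 \<le> len \<and>
     (\<forall>c<h 4. h (6 + c) = Suc c) \<and> len - (6 + h 4) = h 5 * h 3 \<and>
     (\<forall>i<len - (6 + h 4). h (6 + h 4 + i) \<le> h 4)"

lemma reaches_validate: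
  "reaches validate ((\<lambda>_. 0)(0 := len)) h (19 * len + 47) (\<lambda>g h'. h' = h \<and> g 0 = 0 \<and> g rOne = 1 \<and>
     g rLen = len \<and> g rK = h 0 \<and> g rL = h 1 \<and> g rX = h 2 \<and> g rN = h 3 \<and> g rM = h 4 \<and> g rTau = h 5 \<and>
     (g rB = 0 \<longleftrightarrow> well_formed len h))"
  unfolding validate_def
proof (rule reaches_Seq[OF reaches_load_input, where ?T2.0 = "19 * len + 21"], goal_cases)
  case (1 g1 h1)
  then have h1: "h1 = h" by blast
  have f1: "g1 0 = 0" "g1 rOne = 1" "g1 rLen = len" "g1 rK = h 0" "g1 rL = h 1" "g1 rX = h 2"
    "g1 rN = h 3" "g1 rM = h 4" "g1 rTau = h 5" "g1 rP = 6" using 1 by blast+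
  have b1: "g1 rB = 0 \<longleftrightarrow> 1 \<le> h 0 \<and> 1 \<le> h 2 \<and> 1 \<le> h 3 \<and> 1 \<le> h 4 \<and> 1 \<le> h 5"
    using 1 by blast
  show ?case unfolding h1
  proof (rule reaches_Seq[OF reaches_check_length, where ?T2.0 = "19 * len + 18"], goal_cases)
    case (1 g2 h2)
    then have h2: "h2 = h" by blast
    have f2: "g2 0 = 0" "g2 rOne = 1" "g2 rLen = len" "g2 rK = h 0" "g2 rL = h 1" "g2 rX = h 2"
      "g2 rN = h 3" "g2 rM = h 4" "g2 rTau = h 5" "g2 rP = 6"
      using 1(2) f1 by (simp_all add: same_except_def)
    have b2: "g2 rB = 0 \<longleftrightarrow> g1 rB = 0 \<and> 6 + h 4 \<le> len" using 1(1) f1 by simp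
    show ?case unfolding h2
    proof (rule reaches_Seq[OF reaches_check_cands[where n = len], where ?T2.0 = "10 * len + 15"], goal_cases)
      case (4 g3 h3)
      then have h3: "h3 = h" by blast
      have f3: "g3 0 = 0" "g3 rOne = 1" "g3 rLen = len" "g3 rK = h 0" "g3 rL = h 1" "g3 rX = h 2"
        "g3 rN = h 3" "g3 rM = h 4" "g3 rTau = h 5"
        using 4(2) f2 by (simp_all add: same_except_def)
      have p3: "g3 rB = 0 \<Longrightarrow> g3 rP = 6 + h 4" using 4(1) f2 by simp
      have b3: "g3 rB = 0 \<longleftrightarrow> g2 rB = 0 \<and> (\<forall>c<h 4. h (6 + c) = Suc c)" using 4(1) f2 by simp
      show ?case unfolding h3
      proof (rule reaches_Seq[OF reaches_check_count, where ?T2.0 = "6 * len + 2"], goal_cases)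
        case (3 g4 h4)
        then have h4: "h4 = h" by blast
        have f4: "g4 0 = 0" "g4 rOne = 1" "g4 rLen = len" "g4 rK = h 0" "g4 rL = h 1" "g4 rX = h 2"
          "g4 rN = h 3" "g4 rM = h 4" "g4 rTau = h 5" "g4 rP = g3 rP"
          using 3(2) f3 by (simp_all add: same_except_def)
        have b4: "g4 rB = 0 \<longleftrightarrow> g3 rB = 0 \<and> len - (6 + h 4) = h 5 * h 3"
          using 3(1) f3 p3 by auto
        have p4: "g4 rP < len" if "g4 rB = 0"
        proof -
          have "0 < h 5 * h 3" using that b1 b2 b3 b4 by simp
          moreover have "len - (6 + h 4) = h 5 * h 3" using that b4 by blast
          ultimately have "6 + h 4 < len" by linarith
          then show ?thesis using that f4 b4 p3 by simp
        qed
        show ?case unfolding h4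
        proof (rule reaches_conseq[OF reaches_check_votes], goal_cases)
          case (4 g5 h5)
          have f5: "g5 0 = 0" "g5 rOne = 1" "g5 rLen = len" "g5 rK = h 0" "g5 rL = h 1" "g5 rX = h 2"
            "g5 rN = h 3" "g5 rM = h 4" "g5 rTau = h 5"
            using 4(2) f4 by (simp_all add: same_except_def)
          have "g5 rB = 0 \<longleftrightarrow> g4 rB = 0 \<and> (\<forall>i<len - (6 + h 4). h (6 + h 4 + i) \<le> h 4)"
            using 4(1) f4 p3 b4 by auto
          then have "g5 rB = 0 \<longleftrightarrow> well_formed len h"
            unfolding b4 b3 b2 b1 well_formed_def by blast
          then show ?case using f5 4(1) by blast
        qed (use f4 p4 in auto)
      qed (use f3 b1 b2 b3 in auto)
    qed (use f2 b1 b2 in auto)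
  qed simp
qed simp

section \<open>Encodings of instances\<close>

lemma nth_concat_const:
  assumes "\<And>xs. xs \<in> set xss \<Longrightarrow> length xs = n" "t < length xss" "a < n"
  shows "concat xss ! (t * n + a) = xss ! t ! a"
  using assms
proof (induction xss arbitrary: t)
  case (Cons xs xss)
  have n: "length xs = n" using Cons.prems(1) by simp
  show ?case
  proof (cases t)
    case 0
    then show ?thesis using Cons.prems n by (simp add: nth_append)
  next
    case (Suc t')
    have "concat xss ! (t' * n + a) = xss ! t' ! a"
      using Cons.prems Suc by (intro Cons.IH) auto
    then show ?thesis using Suc n by (simp add: nth_append)
  qed
qed simp

definition vote_rows :: "mpv_instance \<Rightarrow> nat list list" where
  "vote_rows I = map (\<lambda>t. map (\<lambda>a. encode_vote (vote I t a)) [1..<num_agents I + 1])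
     [1..<num_profiles I + 1]"

lemma encode_eq:
  "encode I = [size_bound I, change_bound I, score_bound I, num_agents I, num_cands I, num_profiles I]
     @ [1..<num_cands I + 1] @ concat (vote_rows I)"
  by (simp add: encode_def encode_without_k_def vote_rows_def)

lemma length_vote_rows: "length (concat (vote_rows I)) = num_profiles I * num_agents I"
  unfolding vote_rows_def by (subst length_concat_const[where n = "num_agents I"]) auto

lemma nth_vote_rows:
  assumes "t < num_profiles I" "a < num_agents I"
  shows "concat (vote_rows I) ! (t * num_agents I + a) = encode_vote (vote I (Suc t) (Suc a))"
proof -
  have "concat (vote_rows I) ! (t * num_agents I + a) = vote_rows I ! t ! a"
    by (rule nth_concat_const) (use assms in \<open>auto simp: vote_rows_def\<close>)
  then show ?thesis using assms by (simp add: vote_rows_def del: upt_Suc)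
qed

lemma length_encode: "length (encode I) = 6 + num_cands I + num_profiles I * num_agents I"
  unfolding encode_eq length_append length_vote_rows by simp

lemma nth_encode:
  "encode I ! 0 = size_bound I" "encode I ! 1 = change_bound I" "encode I ! 2 = score_bound I"
  "encode I ! 3 = num_agents I" "encode I ! 4 = num_cands I" "encode I ! 5 = num_profiles I"
  by (simp_all add: encode_eq numeral_eq_Suc del: upt_Suc)

lemma nth_encode_cand: "c < num_cands I \<Longrightarrow> encode I ! (6 + c) = Suc c"
  by (simp add: encode_eq nth_append del: upt_Suc)

lemma nth_encode_vote:
  "encode I ! (6 + num_cands I + i) = concat (vote_rows I) ! i"
  by (simp add: encode_eq nth_append del: upt_Suc)

lemma encode_vote_le:
  assumes "I \<in> mpv_instances" "t < num_profiles I" "a < num_agents I"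
  shows "encode_vote (vote I (Suc t) (Suc a)) \<le> num_cands I"
proof -
  have "vote I (Suc t) (Suc a) \<in> insert None (Some ` cands I)"
    using assms by (simp add: mpv_instances_def agents_def)
  then show ?thesis by (auto simp: encode_vote_def cands_def)
qed

lemma div_mod_lt:
  assumes "i < \<tau> * (n::nat)"
  shows "i div n < \<tau>" "i mod n < n" "i = i div n * n + i mod n"
  using assms by (auto simp: less_mult_imp_div_less) (metis mod_less_divisor mult_0_right not_gr_zero not_less_zero)

lemma well_formed_encode:
  assumes "I \<in> mpv_instances"
  shows "well_formed (length (encode I)) (mem_of (encode I))"
proof -
  have "encode I ! (6 + num_cands I + i) \<le> num_cands I" if "i < num_profiles I * num_agents I" for i
    unfolding nth_encode_vote
    using div_mod_lt[OF that] nth_vote_rows[of "i div num_agents I" I "i mod num_agents I"]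
      encode_vote_le[OF assms, of "i div num_agents I" "i mod num_agents I"] by simp
  then show ?thesis
    using assms by (auto simp: well_formed_def length_encode nth_encode nth_encode_cand mpv_instances_def)
qed

lemma encode_of_well_formed:
  assumes wf: "well_formed (length w) (mem_of w)"
  shows "\<exists>I\<in>mpv_instances. w = encode I"
proof -
  define m n \<tau> where "m = w ! 4" "n = w ! 3" "\<tau> = w ! 5"
  have len: "6 \<le> length w" using wf by (simp add: well_formed_def)
  then have h: "mem_of w 0 = w ! 0" "mem_of w 2 = w ! 2" "mem_of w 3 = n" "mem_of w 4 = m" "mem_of w 5 = \<tau>"
    by (simp_all add: m_n_\<tau>_def mem_of_def del: length_greater_0_conv)
  note wf' = wf[unfolded well_formed_def h]
  have w: "1 \<le> w ! 0" "1 \<le> w ! 2" "1 \<le> n" "1 \<le> m" "1 \<le> \<tau>" "length w = 6 + m + \<tau> * n"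
    using wf' by auto
  have w7: "w ! (6 + c) = Suc c" if "c < m" for c
    using wf' that by (simp add: w(6))
  have w8: "w ! (6 + m + i) \<le> m" if "i < \<tau> * n" for i
    using wf' that by (simp add: w(6))
  define v where "v t a = w ! (6 + m + (t - 1) * n + (a - 1))" for t a
  define I where "I = \<lparr>num_agents = n, num_cands = m, num_profiles = \<tau>,
    vote = (\<lambda>t a. if v t a = 0 then None else Some (v t a)),
    size_bound = w ! 0, change_bound = w ! 1, score_bound = w ! 2\<rparr>"
  have ev: "encode_vote (vote I t a) = v t a" for t a
    by (simp add: I_def encode_vote_def)
  have vm: "v t a \<le> m" if "t \<in> {1..\<tau>}" "a \<in> {1..n}" for t a
  proof -
    have "(t - 1) * n + (a - 1) < t * n" using that by (cases t) auto
    also have "\<dots> \<le> \<tau> * n" using that by simp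
    finally show ?thesis using w8 by (simp add: v_def add.assoc)
  qed
  have "I \<in> mpv_instances"
    using w(1-5) vm by (auto simp: mpv_instances_def I_def agents_def cands_def)
  moreover have "w = encode I"
  proof (rule nth_equalityI)
    show L: "length w = length (encode I)" using w(6) by (simp add: length_encode I_def)
    fix i assume i: "i < length w"
    consider "i < 6" | c where "c < m" "i = 6 + c" | j where "j < \<tau> * n" "i = 6 + m + j"
      using i w(6) by (metis add.assoc le_add_diff_inverse less_diff_conv2 nat_add_left_cancel_less not_less)
    then show "w ! i = encode I ! i"
    proof cases
      case 1
      then have "i \<in> {0, 1, 2, 3, 4, 5}" by auto
      then show ?thesis using nth_encode[of I] by (auto simp: I_def m_n_\<tau>_def)
    next
      case 2
      then show ?thesis using w7 nth_encode_cand[of c I] by (simp add: I_def)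
    next
      case 3
      let ?t = "j div n" and ?a = "j mod n"
      note j = div_mod_lt[OF 3(1)]
      have "encode I ! i = v (Suc ?t) (Suc ?a)"
        using j nth_encode_vote[of I j] nth_vote_rows[of ?t I ?a] ev 3 by (simp add: I_def)
      then show ?thesis using 3 by (simp add: v_def add.assoc)
    qed
  qed
  ultimately show ?thesis by blast
qed

section \<open>Correctness of the dynamic program\<close>

definition mpv :: "bool \<Rightarrow> mpv_instance \<Rightarrow> bool" where
  "mpv cons I \<longleftrightarrow> (\<exists>C. committees I C \<and> (\<forall>t\<in>{1..<num_profiles I}.
     change_ok cons (change_bound I) (card (sym_diff (C t) (C (t + 1))))))"

lemma CMPV_eq_mpv: "CMPV = mpv True" and RMPV_eq_mpv: "RMPV = mpv False"
  by (auto simp: fun_eq_iff CMPV_def RMPV_def mpv_def change_ok_def)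

lemma feasible_iff:
  assumes "C \<in> \<C>"
  shows "feasible cons l \<C> ok (Suc t) C \<longleftrightarrow> (\<exists>D. D (Suc t) = C \<and>
    (\<forall>s\<in>{1..Suc t}. D s \<in> \<C> \<and> ok s (D s)) \<and>
    (\<forall>s\<in>{1..<Suc t}. change_ok cons l (card (sym_diff (D s) (D (s + 1))))))"
  using assms
proof (induction t arbitrary: C)
  case 0
  then show ?case by (auto intro!: exI[of _ "\<lambda>_. C"])
next
  case (Suc t)
  let ?P = "\<lambda>t C D. D (Suc t) = C \<and> (\<forall>s\<in>{1..Suc t}. D s \<in> \<C> \<and> ok s (D s)) \<and>
    (\<forall>s\<in>{1..<Suc t}. change_ok cons l (card (sym_diff (D s) (D (s + 1)))))"
  show ?case
  proof
    assume "feasible cons l \<C> ok (Suc (Suc t)) C"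
    then obtain B where B: "ok (Suc (Suc t)) C" "B \<in> \<C>" "feasible cons l \<C> ok (Suc t) B"
      "change_ok cons l (card (sym_diff C B))"
      unfolding feasible.simps(2)[of _ _ _ _ "Suc t"] by blast
    from Suc.IH[OF B(2)] B(3) obtain D where D: "?P t B D" by blast
    have "?P (Suc t) C (D(Suc (Suc t) := C))"
      using D B Suc.prems by (auto simp: less_Suc_eq le_Suc_eq Un_commute)
    then show "\<exists>D. ?P (Suc t) C D" by blast
  next
    assume "\<exists>D. ?P (Suc t) C D"
    then obtain D where D: "?P (Suc t) C D" by blast
    then have "?P t (D (Suc t)) D" by auto
    moreover have B: "D (Suc t) \<in> \<C>" using D by auto
    ultimately have "feasible cons l \<C> ok (Suc t) (D (Suc t))" using Suc.IH by blast
    moreover have "change_ok cons l (card (sym_diff (D (Suc t)) C))" "ok (Suc (Suc t)) C" using D by auto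
    ultimately show "feasible cons l \<C> ok (Suc (Suc t)) C"
      unfolding feasible.simps(2)[of _ _ _ _ "Suc t"] using B
      by (intro conjI bexI[of _ "D (Suc t)"]) (simp_all add: Un_commute del: feasible.simps)
  qed
qed

lemma mpv_iff_feasible:
  assumes I: "I \<in> mpv_instances"
  defines "L \<equiv> set (level (num_cands I) (size_bound I))"
  shows "mpv cons I \<longleftrightarrow> (\<exists>C\<in>L. feasible cons (change_bound I) L
    (\<lambda>t C. score_bound I \<le> score I t C) (num_profiles I) C)"
proof -
  have pos: "1 \<le> size_bound I" "1 \<le> score_bound I" "1 \<le> num_profiles I"
    using I by (auto simp: mpv_instances_def)
  have L: "C \<in> L \<and> score_bound I \<le> score I t C \<longleftrightarrow>
    C \<subseteq> cands I \<and> card C \<le> size_bound I \<and> score I t C \<ge> score_bound I" for C t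
    using pos by (auto simp: L_def set_level cands_def score_def)
  obtain \<tau> where \<tau>: "num_profiles I = Suc \<tau>" using pos by (cases "num_profiles I") auto
  have "mpv cons I \<longleftrightarrow> (\<exists>D. (\<forall>s\<in>{1..Suc \<tau>}. D s \<in> L \<and> score_bound I \<le> score I s (D s)) \<and>
    (\<forall>s\<in>{1..<Suc \<tau>}. change_ok cons (change_bound I) (card (sym_diff (D s) (D (s + 1))))))"
    unfolding mpv_def committees_def \<tau> L[symmetric] by blast
  also have "\<dots> \<longleftrightarrow> (\<exists>C\<in>L. feasible cons (change_bound I) L
    (\<lambda>t C. score_bound I \<le> score I t C) (Suc \<tau>) C)"
  proof -
    let ?A = "\<lambda>D. (\<forall>s\<in>{1..Suc \<tau>}. D s \<in> L \<and> score_bound I \<le> score I s (D s)) \<and>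
      (\<forall>s\<in>{1..<Suc \<tau>}. change_ok cons (change_bound I) (card (sym_diff (D s) (D (s + 1)))))"
    have "(\<exists>C\<in>L. feasible cons (change_bound I) L (\<lambda>t C. score_bound I \<le> score I t C) (Suc \<tau>) C)
        \<longleftrightarrow> (\<exists>C\<in>L. \<exists>D. D (Suc \<tau>) = C \<and> ?A D)"
      by (intro bex_cong refl feasible_iff)
    moreover have "D (Suc \<tau>) \<in> L" if "?A D" for D using that by simp
    ultimately show ?thesis by blast
  qed
  finally show ?thesis unfolding \<tau> .
qed

section \<open>The decision procedure\<close>

definition program :: "bool \<Rightarrow> com" where
  "program cons = validate ;; Unless rB (solve cons)"

lemma reaches_program_ill_formed:
  assumes "\<not> well_formed len h"
  shows "reaches (program cons) ((\<lambda>_. 0)(0 := len)) h (19 * len + 48) (\<lambda>g h. g 0 = 0)"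
  unfolding program_def
  by (rule reaches_Seq[OF reaches_validate, where ?T2.0 = 1],
      rule reaches_Unless[where T = 0]) (use assms in auto)

lemma score_eq_card:
  assumes "C \<subseteq> {1..num_cands I}" "t < num_profiles I"
  shows "score I (Suc t) C =
    card {a. a < num_agents I \<and> mem_of (encode I) (6 + num_cands I + t * num_agents I + a) \<in> C}"
proof -
  let ?n = "num_agents I"
  have m: "mem_of (encode I) (6 + num_cands I + t * ?n + a) = encode_vote (vote I (Suc t) (Suc a))"
    if "a < ?n" for a
  proof -
    have "t * ?n + a < num_profiles I * ?n"
      using that assms(2) mult_le_mono1[of "Suc t" "num_profiles I" ?n] by simp
    then show ?thesis
      using that assms(2) nth_encode_vote[of I "t * ?n + a"] nth_vote_rows[of t I a]
      by (simp add: length_encode add.assoc)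
  qed
  have ev: "encode_vote v \<in> C \<longleftrightarrow> v \<in> Some ` C" for v
    using assms(1) by (cases v) (auto simp: encode_vote_def)
  have "{a \<in> agents I. vote I (Suc t) a \<in> Some ` C} =
    Suc ` {a. a < ?n \<and> mem_of (encode I) (6 + num_cands I + t * ?n + a) \<in> C}"
  proof -
    have "{a \<in> agents I. vote I (Suc t) a \<in> Some ` C} =
      Suc ` {a. a < ?n \<and> vote I (Suc t) (Suc a) \<in> Some ` C}"
      by (auto simp: agents_def image_iff Suc_le_eq gr0_conv_Suc)
    also have "{a. a < ?n \<and> vote I (Suc t) (Suc a) \<in> Some ` C} =
      {a. a < ?n \<and> mem_of (encode I) (6 + num_cands I + t * ?n + a) \<in> C}"
      using m ev by (intro Collect_cong conj_cong refl) metis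
    finally show ?thesis .
  qed
  then show ?thesis unfolding score_def by (simp add: card_image)
qed

definition time_bound :: "mpv_instance \<Rightarrow> nat" where
  "time_bound I = num_profiles I * (size_bound I)\<^sup>2 * num_cands I ^ (2 * size_bound I + 1) * num_agents I"

lemma le_of_factor: "(b::nat) = x * y \<Longrightarrow> 0 < y \<Longrightarrow> x \<le> b"
  by simp

lemma total_time_le:
  fixes \<tau> k m n :: nat
  assumes "1 \<le> \<tau>" "1 \<le> k" "1 \<le> m" "1 \<le> n"
  shows "19 * (6 + m + \<tau> * n) + 47 + Suc
    ((k * (m ^ k * (6 * m + 11) + 5 * m + 7) + 5) + (6 +
     (\<tau> * (m ^ k * (m ^ k * (10 * m + 21) + 7 * n + 15) + 8) + (m ^ k * 6 + 4)))) \<le>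
    400 * (\<tau> * k\<^sup>2 * m ^ (2 * k + 1) * n)"
proof -
  define N where "N = m ^ k"
  have N: "0 < N" using assms by (simp add: N_def)
  define b where "b = \<tau> * k\<^sup>2 * m ^ (2 * k + 1) * n"
  have "m ^ (2 * k + 1) = N * N * m" by (simp add: N_def mult_2 power_add)
  then have b: "b = \<tau> * k * k * N * N * m * n"
    unfolding b_def by (simp only: power2_eq_square mult.assoc)
  have pos: "0 < \<tau>" "0 < k" "0 < m" "0 < n" using assms by auto
  note p = pos N
  have 1: "1 \<le> b" using p by (simp add: b)
  have 2: "m \<le> b" by (rule le_of_factor[where y = "\<tau> * k * k * N * N * n"]) (use p in \<open>simp_all add: b\<close>)
  have 3: "\<tau> * n \<le> b" by (rule le_of_factor[where y = "k * k * N * N * m"]) (use p in \<open>simp_all add: b\<close>)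
  have 4: "k * N * m \<le> b" by (rule le_of_factor[where y = "\<tau> * k * N * n"]) (use p in \<open>simp_all add: b\<close>)
  have 5: "k * N \<le> b" by (rule le_of_factor[where y = "\<tau> * k * N * m * n"]) (use p in \<open>simp_all add: b\<close>)
  have 6: "k * m \<le> b" by (rule le_of_factor[where y = "\<tau> * k * N * N * n"]) (use p in \<open>simp_all add: b\<close>)
  have 7: "k \<le> b" by (rule le_of_factor[where y = "\<tau> * k * N * N * m * n"]) (use p in \<open>simp_all add: b\<close>)
  have 8: "\<tau> * N * N * m \<le> b" by (rule le_of_factor[where y = "k * k * n"]) (use p in \<open>simp_all add: b\<close>)
  have 9: "\<tau> * N * N \<le> b" by (rule le_of_factor[where y = "k * k * m * n"]) (use p in \<open>simp_all add: b\<close>)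
  have 10: "\<tau> * N * n \<le> b" by (rule le_of_factor[where y = "k * k * N * m"]) (use p in \<open>simp_all add: b\<close>)
  have 11: "\<tau> * N \<le> b" by (rule le_of_factor[where y = "k * k * N * m * n"]) (use p in \<open>simp_all add: b\<close>)
  have 12: "\<tau> \<le> b" by (rule le_of_factor[where y = "k * k * N * N * m * n"]) (use p in \<open>simp_all add: b\<close>)
  have 13: "N \<le> b" by (rule le_of_factor[where y = "\<tau> * k * k * N * m * n"]) (use p in \<open>simp_all add: b\<close>)
  have "19 * (6 + m + \<tau> * n) + 47 + Suc
    ((k * (N * (6 * m + 11) + 5 * m + 7) + 5) + (6 +
     (\<tau> * (N * (N * (10 * m + 21) + 7 * n + 15) + 8) + (N * 6 + 4)))) =
    177 + 19 * m + 19 * (\<tau> * n) + 6 * (k * N * m) + 11 * (k * N) + 5 * (k * m) + 7 * k +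
    10 * (\<tau> * N * N * m) + 21 * (\<tau> * N * N) + 7 * (\<tau> * N * n) + 15 * (\<tau> * N) + 8 * \<tau> + 6 * N"
    by (simp add: algebra_simps)
  also have "\<dots> \<le> 400 * b" using 1 2 3 4 5 6 7 8 9 10 11 12 13 by linarith
  finally show ?thesis by (simp only: b_def N_def)
qed

lemma reaches_program_encode:
  assumes I: "I \<in> mpv_instances"
  shows "reaches (program cons) ((\<lambda>_. 0)(0 := length (encode I))) (mem_of (encode I))
    (400 * time_bound I) (\<lambda>g h. g 0 = of_bool (mpv cons I))"
proof -
  let ?h = "mem_of (encode I)"
  let ?m = "num_cands I" and ?n = "num_agents I" and ?\<tau> = "num_profiles I" and ?k = "size_bound I"
  have pos: "1 \<le> ?m" "1 \<le> ?k" "1 \<le> ?n" "1 \<le> ?\<tau>" using I by (auto simp: mpv_instances_def)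
  have h: "?h 0 = ?k" "?h 1 = change_bound I" "?h 2 = score_bound I" "?h 3 = ?n" "?h 4 = ?m" "?h 5 = ?\<tau>"
    by (simp_all add: nth_encode length_encode del: One_nat_def)
  let ?T = "(?k * (?m ^ ?k * (6 * ?m + 11) + 5 * ?m + 7) + 5) + (6 +
     (?\<tau> * (?m ^ ?k * (?m ^ ?k * (10 * ?m + 21) + 7 * ?n + 15) + 8) + (?m ^ ?k * 6 + 4)))"
  show ?thesis unfolding program_def
  proof (rule reaches_Seq[OF reaches_validate, where ?T2.0 = "Suc ?T"], goal_cases)
    case (1 g h)
    have f: "h = ?h" "g 0 = 0" "g rOne = 1" "g rLen = length (encode I)" "g rK = ?k"
      "g rL = change_bound I" "g rX = score_bound I" "g rN = ?n" "g rM = ?m" "g rTau = ?\<tau>" "g rB = 0"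
      using 1(1) h well_formed_encode[OF I] by auto
    show ?case unfolding f(1) mpv_iff_feasible[OF I]
    proof (rule reaches_Unless[where T = ?T], goal_cases)
      case 1
      have v: "?h (6 + ?m + t * ?n + a) \<le> ?m" if "t < ?\<tau>" "a < ?n" for t a
      proof -
        have "t * ?n + a < ?\<tau> * ?n" using that mult_le_mono1[of "Suc t" ?\<tau> ?n] by simp
        then show ?thesis
          using well_formed_encode[OF I] unfolding well_formed_def h by (simp add: length_encode add.assoc)
      qed
      have ok: "(\<lambda>t C. score_bound I \<le> score I t C) (Suc t) C \<longleftrightarrow>
        g rX \<le> card {a. a < ?n \<and> ?h (6 + ?m + t * ?n + a) \<in> C}"
        if "t < ?\<tau>" "C \<in> set (level ?m ?k)" for t C
        using that score_eq_card[of C I t] f(7) by (simp add: set_level)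
      show ?case
        using reaches_solve[where g = g and h = ?h and m = ?m and n = ?n and \<tau> = ?\<tau> and k = ?k
            and ok = "\<lambda>t C. score_bound I \<le> score I t C" and cons = cons, OF f(2,3,9,5,8,10) pos(1,2) _ _ _ _ v ok] f pos
        by (simp add: length_encode)
    qed (use f in simp_all)
  next
    case 2
    then show ?case
      unfolding length_encode time_bound_def using total_time_le[OF pos(4,2,1,3)] by simp
  qed
qed

lemma program_on_instances:
  assumes "I \<in> mpv_instances"
  shows "halts (compile 0 (program cons)) (encode I)"
    "result (compile 0 (program cons)) (encode I) = of_bool (mpv cons I)"
    "run_time (compile 0 (program cons)) (encode I) \<le> 400 * time_bound I"
  by (rule reaches_run[OF reaches_program_encode[OF assms]])+

lemma solvable_mpv: "solvable_in_time mpv_instances encode (mpv cons) time_bound"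
  unfolding solvable_in_time_def
proof (intro exI conjI)
  show "\<forall>I\<in>mpv_instances. halts (compile 0 (program cons)) (encode I) \<and>
     result (compile 0 (program cons)) (encode I) = of_bool (mpv cons I)"
    using program_on_instances by blast
  show "(\<lambda>I. real (run_time (compile 0 (program cons)) (encode I)))
    \<in> O[principal mpv_instances](\<lambda>I. real (time_bound I))"
  proof (rule bigoI[where c = 400], unfold eventually_principal, intro ballI)
    fix I assume "I \<in> mpv_instances"
    from program_on_instances(3)[OF this, of cons]
    have "real (run_time (compile 0 (program cons)) (encode I)) \<le> real (400 * time_bound I)"
      by (simp only: of_nat_le_iff)
    then show "norm (real (run_time (compile 0 (program cons)) (encode I))) \<le> 400 * norm (real (time_bound I))"
      by simp
  qed
qed

lemma computable_const: "computable (\<lambda>_. c)"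
  unfolding computable_def
proof (intro exI allI conjI)
  fix k
  let ?c = "Blk [Const 0 c]"
  have "reaches ?c ((\<lambda>_. 0)(0 := length [k])) (mem_of [k]) 1 (\<lambda>g h. g 0 = c)"
    by (rule reaches_Blk) simp_all
  from reaches_run[OF this] show "halts (compile 0 ?c) [k]" "result (compile 0 ?c) [k] = c" by simp_all
qed

lemma computable_linear: "computable (\<lambda>k. 4 * k + 2)"
  unfolding computable_def
proof (intro exI allI conjI)
  fix k
  let ?c = "Blk [Const 2 0, Load 3 2, Add 3 3 3, Add 3 3 3, Const 4 2, Add 0 3 4]"
  have "reaches ?c ((\<lambda>_. 0)(0 := length [k])) (mem_of [k]) 6 (\<lambda>g h. g 0 = 4 * k + 2)"
    by (rule reaches_Blk) simp_all
  from reaches_run[OF this] show "halts (compile 0 ?c) [k]" "result (compile 0 ?c) [k] = 4 * k + 2"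
    by simp_all
qed

lemma length_le_input_size: "length w \<le> input_size w"
  by (induction w) (simp_all add: input_size_def)

lemma time_bound_le_input_size:
  "time_bound I \<le> input_size (encode I) ^ (4 * size_bound I + 2)"
proof -
  let ?k = "size_bound I"
  define z where "z = input_size (encode I)"
  have len: "6 + num_cands I + num_profiles I * num_agents I \<le> z"
    using length_le_input_size[of "encode I"] by (simp add: z_def length_encode)
  have "?k \<le> 2 ^ ?k" using less_exp[of ?k] by simp
  also have "\<dots> \<le> z ^ ?k" using len by (intro power_mono) auto
  finally have kz: "?k\<^sup>2 \<le> z ^ ?k * z ^ ?k" by (simp add: power2_eq_square mult_le_mono)
  have mz: "num_cands I ^ (2 * ?k + 1) \<le> z ^ (2 * ?k + 1)" using len by (intro power_mono) auto
  have "time_bound I = (num_profiles I * num_agents I) * (?k\<^sup>2 * num_cands I ^ (2 * ?k + 1))"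
    by (simp add: time_bound_def mult_ac)
  also have "\<dots> \<le> z * (z ^ ?k * z ^ ?k * z ^ (2 * ?k + 1))"
    using kz mz len by (intro mult_le_mono) auto
  also have "\<dots> = z ^ (4 * ?k + 2)"
  proof -
    have "4 * ?k + 2 = 1 + (?k + ?k + (2 * ?k + 1))" by simp
    then show ?thesis by (simp only: power_add power_one_right)
  qed
  finally show ?thesis by (simp add: z_def)
qed

lemma parameterized_mpv_in_XP: "parameterized_by_k (mpv cons) \<in> XP"
proof -
  let ?P = "compile 0 (program cons)"
  let ?L = "parameterized_by_k (mpv cons)"
  have mem: "(w, k) \<in> ?L \<longleftrightarrow> (\<exists>I\<in>mpv_instances. mpv cons I \<and> encode I = k # w)" for w k
    by (auto simp: parameterized_by_k_def encode_def)
  have "halts ?P (k # w) \<and> result ?P (k # w) = of_bool ((w, k) \<in> ?L) \<and>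
    run_time ?P (k # w) \<le> 400 * input_size (k # w) ^ (4 * k + 2)" for w k
  proof (cases "\<exists>I\<in>mpv_instances. encode I = k # w")
    case True
    then obtain I where I: "I \<in> mpv_instances" "encode I = k # w" by blast
    note prog = program_on_instances[OF I(1), of cons, unfolded I(2)]
    have "mpv cons I \<longleftrightarrow> mpv cons J" if "J \<in> mpv_instances" "encode J = k # w" for J
    proof -
      have "of_bool (mpv cons I) = (of_bool (mpv cons J) :: nat)"
        using program_on_instances(2)[OF that(1), of cons] prog(2) that(2) by simp
      then show ?thesis by (simp only: of_bool_eq_iff)
    qed
    then have "(w, k) \<in> ?L \<longleftrightarrow> mpv cons I" unfolding mem using I by blast
    moreover have "size_bound I = k" using I(2) by (simp add: encode_def)
    ultimately show ?thesis
      using prog time_bound_le_input_size[of I] I(2) by simp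
  next
    case False
    then have nL: "(w, k) \<notin> ?L" by (auto simp: mem)
    have "\<not> well_formed (length (k # w)) (mem_of (k # w))"
      using False encode_of_well_formed[of "k # w"] by (auto dest: sym)
    note prog = reaches_run[OF reaches_program_ill_formed[OF this, of cons]]
    let ?z = "input_size (k # w)"
    have z: "length (k # w) \<le> ?z" by (rule length_le_input_size)
    have "run_time ?P (k # w) \<le> 400 * ?z" using prog(3) z by simp
    also have "\<dots> \<le> 400 * ?z ^ (4 * k + 2)" using z by (intro mult_le_mono self_le_power) auto
    finally show ?thesis using prog(1,2) nL by simp
  qed
  then show ?thesis unfolding XP_def using computable_const computable_linear by blast
qed

theorem theorem13:
  shows "solvable_in_time mpv_instances encode CMPV
           (\<lambda>I. num_profiles I * (size_bound I)\<^sup>2 * num_cands I ^ (2 * size_bound I + 1) * num_agents I)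
       \<and> solvable_in_time mpv_instances encode RMPV
           (\<lambda>I. num_profiles I * (size_bound I)\<^sup>2 * num_cands I ^ (2 * size_bound I + 1) * num_agents I)
       \<and> parameterized_by_k CMPV \<in> XP
       \<and> parameterized_by_k RMPV \<in> XP"
  unfolding CMPV_eq_mpv RMPV_eq_mpv
  using solvable_mpv[unfolded time_bound_def] parameterized_mpv_in_XP by blast

end
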